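(* Let the initial data $a_0,\dot a_0,b_0$ and the reference trajectories $(x_0,y_0)$ be fixed as in the context. There are constants $\tilde v,\tilde V\in\,]0,1[$ and $\tilde A,\tilde D,\tilde T>0$ such that, for any $\lambda\in[0,1]$ and any $(x,y)\in M$ with $H(\lambda,x,y)=(x,y)$, the functions $X=x+x_0$, $Y=y+y_0$ satisfy $$\|\dot X\|_\infty,\ \|\dot Y\|_\infty<\tilde V,\qquad \inf_{t\ge0}(X-Y)(t)>\tilde D,\qquad \inf_{t\ge\tilde T}(\dot X-\dot Y)(t)>\tilde v,$$ $$|\ddot X(t)|<\frac{\tilde A}{1+|t|}\ \ (t\ge0),\qquad |\ddot Y(t)|<\frac{\tilde A}{1+|t|}\ \ (t>T^+).$$
   Context: Fixed constants $\kappa_a,\kappa_b>0$. Initial data: $a_0\in\mathbb R$, $\dot a_0\in\,]-1,1[$, and $b_0\in C^1([T^-,T^+],\,]-\infty,a_0[)$ with $T^\pm=\pm(a_0-b_0(T^\pm))$ and $\|\dot b_0\|_\infty<1$. Reference trajectories: $x_0\in C^2(\mathbb R_0^+)$ and $y_0\in C^1([T^-,\infty[)\cap C^2(]T^+,\infty[)$, with $\ddot y_0$ bounded and uniformly continuous on $]T^+,\infty[$, satisfying the initial data ($x_0(0)=a_0$, $\dot x_0(0)=\dot a_0$, $y_0|_{[T^-,T^+]}=b_0$) and: $\|\dot x_0\|_\infty,\|\dot y_0\|_\infty<1$; $\inf_{t\ge0}(x_0(t)-y_0(t))>0$; $(\dot x_0-\dot y_0)(T^++1)>0$; $\ddot x_0(t)\ge0$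 for $t\ge0$ and $\ddot y_0(t)\le0$ for $t>T^+$; $\ddot x_0(t)=\ddot y_0(t)=0$ for $t\ge T^++1$. For a pair $(x,y)$ write $X:=x+x_0$, $Y:=y+y_0$. Advanced/retarded times: $t_1^\pm(X,Y,t)=t\pm|X(t_1^\pm)-Y(t)|$, $t_2^\pm(X,Y,t)=t\pm|X(t)-Y(t_2^\pm)|$. Forces (with $t_i^\pm=t_i^\pm(X,Y,t)$): $$F_1(X,Y)(t)=\frac{1+\dot Y(t_2^-)}{1-\dot Y(t_2^-)}\frac1{(X(t)-Y(t_2^-))^2}+\frac{1-\dot Y(t_2^+)}{1+\dot Y(t_2^+)}\frac1{(X(t)-Y(t_2^+))^2},$$ $$F_2(X,Y)(t)=-\frac{1-\dot X(t_1^-)}{1+\dot X(t_1^-)}\frac1{(Y(t)-X(t_1^-))^2}-\frac{1+\dot X(t_1^+)}{1-\dot X(t_1^+)}\frac1{(Y(t)-X(t_1^+))^2}.$$ Momenta: $$P_1(\lambda,X,Y)(t)=(1-\lambda)\frac{\dot x_0(t)}{\sqrt{1-\dot x_0(t)^2}}+\lambda\frac{\dot a_0}{\sqrt{1-\dot a_0^2}}+\lambda\int_0^t\frac{\kappa_a}2F_1(X,Y)(s)\,ds,$$ $$P_2(\lambda,X,Y)(t)=(1-\lambda)\frac{\dot y_0(t)}{\sqrt{1-\dot y_0(t)^2}}+\lambda\frac{\dot b_0(T^+)}{\sqrt{1-\dot b_0(T^+)^2}}+\lambda\int_{T^+}^t\frac{\kappa_b}2F_2(X,Y)(s)\,ds.$$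 The map $H=(H_1,H_2):[0,1]\times M\to C^1(\mathbb R_0^+)\times C^1([T^-,\infty[)$ is $$H_1(\lambda,x,y)(t)=-x_0(t)+a_0+\int_0^t\frac{P_1(\lambda,X,Y)(s)}{\sqrt{1+P_1(\lambda,X,Y)(s)^2}}\,ds,$$ $$H_2(\lambda,x,y)(t)=\begin{cases}0,&T^-\le t\le T^+,\\ -y_0(t)+b_0(T^+)+\int_{T^+}^t\frac{P_2(\lambda,X,Y)(s)}{\sqrt{1+P_2(\lambda,X,Y)(s)^2}}\,ds,&t\ge T^+.\end{cases}$$ Here $M$ is the set of $(x,y)\in C^1(\mathbb R_0^+)\times C^1([T^-,\infty[)$ with $x(0)=0$, $y|_{[T^-,T^+]}\equiv0$, $\|\dot X\|_\infty,\|\dot Y\|_\infty<1$ and $X(t)>Y(t)$ for all $t\ge0$. $\|\cdot\|_\infty$ is the supremum norm over the domain of the function; derivatives at boundary points are one-sided; $\mathbb R_0^+=[0,\infty[$. *)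

theory Defs
  imports "HOL-Analysis.Analysis"
begin

text \<open>
  A function on a domain \<open>S\<close> is represented by a total function of which only the
  values on \<open>S\<close> are used. Derivatives are taken within \<open>S\<close>, hence they are one-sided at the
  boundary points of an interval.
\<close>

definition dot_on :: "real set \<Rightarrow> (real \<Rightarrow> real) \<Rightarrow> real \<Rightarrow> real" where
  "dot_on S f t = vector_derivative f (at t within S)"

definition ddot_on :: "real set \<Rightarrow> (real \<Rightarrow> real) \<Rightarrow> real \<Rightarrow> real" where
  "ddot_on S f = dot_on S (dot_on S f)"

primrec C_on :: "nat \<Rightarrow> real set \<Rightarrow> (real \<Rightarrow> real) \<Rightarrow> bool" where
  "C_on 0 S f \<longleftrightarrow> continuous_on S f"
| "C_on (Suc k) S f \<longleftrightarrow> f differentiable_on S \<and> C_on k S (dot_on S f)"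

text \<open>
  The supremum norm has values in the extended reals, so that \<open>sup_norm S f < 1\<close> entails
  that \<open>f\<close> is bounded on \<open>S\<close>.
\<close>

definition sup_norm :: "real set \<Rightarrow> (real \<Rightarrow> real) \<Rightarrow> ereal" where
  "sup_norm S f = (SUP t\<in>S. ereal \<bar>f t\<bar>)"

text \<open>
  \<open>X\<close> lives on \<open>{0..}\<close> and \<open>Y\<close> on \<open>{Tm..}\<close>; \<open>Tm\<close> and \<open>Tp\<close> stand for
  \<open>T\<^sup>-\<close> and \<open>T\<^sup>+\<close>, \<open>va\<close> for the initial velocity of the particle starting at \<open>a0\<close>.
\<close>

definition initial_data ::
  "real \<Rightarrow> real \<Rightarrow> real \<Rightarrow> real \<Rightarrow> (real \<Rightarrow> real) \<Rightarrow> bool" where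
  "initial_data Tm Tp a0 va b0 \<longleftrightarrow>
     va \<in> {-1<..<1} \<and>
     Tm < Tp \<and>
     C_on 1 {Tm..Tp} b0 \<and>
     (\<forall>t\<in>{Tm..Tp}. b0 t < a0) \<and>
     Tp = a0 - b0 Tp \<and>
     Tm = - (a0 - b0 Tm) \<and>
     sup_norm {Tm..Tp} (dot_on {Tm..Tp} b0) < 1"

definition reference_trajectories ::
  "real \<Rightarrow> real \<Rightarrow> real \<Rightarrow> real \<Rightarrow> (real \<Rightarrow> real) \<Rightarrow> (real \<Rightarrow> real) \<Rightarrow> (real \<Rightarrow> real) \<Rightarrow> bool" where
  "reference_trajectories Tm Tp a0 va b0 x0 y0 \<longleftrightarrow>
     C_on 2 {0..} x0 \<and>
     C_on 1 {Tm..} y0 \<and>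
     C_on 2 {Tp<..} y0 \<and>
     bounded (ddot_on {Tp<..} y0 ` {Tp<..}) \<and>
     uniformly_continuous_on {Tp<..} (ddot_on {Tp<..} y0) \<and>
     x0 0 = a0 \<and>
     dot_on {0..} x0 0 = va \<and>
     (\<forall>t\<in>{Tm..Tp}. y0 t = b0 t) \<and>
     sup_norm {0..} (dot_on {0..} x0) < 1 \<and>
     sup_norm {Tm..} (dot_on {Tm..} y0) < 1 \<and>
     (INF t\<in>{0..}. ereal (x0 t - y0 t)) > 0 \<and>
     dot_on {0..} x0 (Tp + 1) - dot_on {Tm..} y0 (Tp + 1) > 0 \<and>
     (\<forall>t\<ge>0. ddot_on {0..} x0 t \<ge> 0) \<and>
     (\<forall>t>Tp. ddot_on {Tp<..} y0 t \<le> 0) \<and>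
     (\<forall>t\<ge>Tp + 1. ddot_on {0..} x0 t = 0 \<and> ddot_on {Tp<..} y0 t = 0)"

text \<open>
  Advanced and retarded times, characterised by their implicit equations on the domain of the
  function evaluated at the delayed time. For \<open>(x, y) \<in> M\<close> they exist and are
  unique at all times at which the forces are evaluated, because the velocities are bounded away
  from 1.
\<close>

definition t1_adv :: "(real \<Rightarrow> real) \<Rightarrow> (real \<Rightarrow> real) \<Rightarrow> real \<Rightarrow> real" where
  "t1_adv X Y t = (THE s. s \<ge> 0 \<and> s = t + \<bar>X s - Y t\<bar>)"

definition t1_ret :: "(real \<Rightarrow> real) \<Rightarrow> (real \<Rightarrow> real) \<Rightarrow> real \<Rightarrow> real" where
  "t1_ret X Y t = (THE s. s \<ge> 0 \<and> s = t - \<bar>X s - Y t\<bar>)"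

definition t2_adv :: "real \<Rightarrow> (real \<Rightarrow> real) \<Rightarrow> (real \<Rightarrow> real) \<Rightarrow> real \<Rightarrow> real" where
  "t2_adv Tm X Y t = (THE s. s \<ge> Tm \<and> s = t + \<bar>X t - Y s\<bar>)"

definition t2_ret :: "real \<Rightarrow> (real \<Rightarrow> real) \<Rightarrow> (real \<Rightarrow> real) \<Rightarrow> real \<Rightarrow> real" where
  "t2_ret Tm X Y t = (THE s. s \<ge> Tm \<and> s = t - \<bar>X t - Y s\<bar>)"

definition F1 :: "real \<Rightarrow> (real \<Rightarrow> real) \<Rightarrow> (real \<Rightarrow> real) \<Rightarrow> real \<Rightarrow> real" where
  "F1 Tm X Y t =
     (let dY = dot_on {Tm..} Y; r = t2_ret Tm X Y t; a = t2_adv Tm X Y t in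
       (1 + dY r) / (1 - dY r) * (1 / (X t - Y r)^2)
     + (1 - dY a) / (1 + dY a) * (1 / (X t - Y a)^2))"

definition F2 :: "(real \<Rightarrow> real) \<Rightarrow> (real \<Rightarrow> real) \<Rightarrow> real \<Rightarrow> real" where
  "F2 X Y t =
     (let dX = dot_on {0..} X; r = t1_ret X Y t; a = t1_adv X Y t in
     - ((1 - dX r) / (1 + dX r) * (1 / (Y t - X r)^2))
     - (1 + dX a) / (1 - dX a) * (1 / (Y t - X a)^2))"

definition P1 ::
  "real \<Rightarrow> real \<Rightarrow> real \<Rightarrow> (real \<Rightarrow> real) \<Rightarrow> real \<Rightarrow> (real \<Rightarrow> real) \<Rightarrow> (real \<Rightarrow> real) \<Rightarrow> real \<Rightarrow> real" where
  "P1 \<kappa>a Tm va x0 l X Y t =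
     (1 - l) * (dot_on {0..} x0 t / sqrt (1 - (dot_on {0..} x0 t)^2))
     + l * (va / sqrt (1 - va^2))
     + l * integral {0..t} (\<lambda>s. \<kappa>a / 2 * F1 Tm X Y s)"

definition P2 ::
  "real \<Rightarrow> real \<Rightarrow> real \<Rightarrow> (real \<Rightarrow> real) \<Rightarrow> (real \<Rightarrow> real) \<Rightarrow>
   real \<Rightarrow> (real \<Rightarrow> real) \<Rightarrow> (real \<Rightarrow> real) \<Rightarrow> real \<Rightarrow> real" where
  "P2 \<kappa>b Tm Tp b0 y0 l X Y t =
     (1 - l) * (dot_on {Tm..} y0 t / sqrt (1 - (dot_on {Tm..} y0 t)^2))
     + l * (dot_on {Tm..Tp} b0 Tp / sqrt (1 - (dot_on {Tm..Tp} b0 Tp)^2))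
     + l * integral {Tp..t} (\<lambda>s. \<kappa>b / 2 * F2 X Y s)"

definition H1 ::
  "real \<Rightarrow> real \<Rightarrow> real \<Rightarrow> real \<Rightarrow> (real \<Rightarrow> real) \<Rightarrow> (real \<Rightarrow> real) \<Rightarrow>
   real \<Rightarrow> (real \<Rightarrow> real) \<Rightarrow> (real \<Rightarrow> real) \<Rightarrow> real \<Rightarrow> real" where
  "H1 \<kappa>a Tm a0 va x0 y0 l x y t =
     (let P = P1 \<kappa>a Tm va x0 l (\<lambda>s. x s + x0 s) (\<lambda>s. y s + y0 s) in
     - x0 t + a0 + integral {0..t} (\<lambda>s. P s / sqrt (1 + (P s)^2)))"

definition H2 ::
  "real \<Rightarrow> real \<Rightarrow> real \<Rightarrow> (real \<Rightarrow> real) \<Rightarrow> (real \<Rightarrow> real) \<Rightarrow> (real \<Rightarrow> real) \<Rightarrow>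
   real \<Rightarrow> (real \<Rightarrow> real) \<Rightarrow> (real \<Rightarrow> real) \<Rightarrow> real \<Rightarrow> real" where
  "H2 \<kappa>b Tm Tp b0 x0 y0 l x y t =
     (let P = P2 \<kappa>b Tm Tp b0 y0 l (\<lambda>s. x s + x0 s) (\<lambda>s. y s + y0 s) in
     if t \<le> Tp then 0
     else - y0 t + b0 Tp + integral {Tp..t} (\<lambda>s. P s / sqrt (1 + (P s)^2)))"

definition M ::
  "real \<Rightarrow> real \<Rightarrow> (real \<Rightarrow> real) \<Rightarrow> (real \<Rightarrow> real) \<Rightarrow> ((real \<Rightarrow> real) \<times> (real \<Rightarrow> real)) set" where
  "M Tm Tp x0 y0 =
     {(x, y). C_on 1 {0..} x \<and> C_on 1 {Tm..} y \<and>
        x 0 = 0 \<and> (\<forall>t\<in>{Tm..Tp}. y t = 0) \<and>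
        sup_norm {0..} (dot_on {0..} (\<lambda>t. x t + x0 t)) < 1 \<and>
        sup_norm {Tm..} (dot_on {Tm..} (\<lambda>t. y t + y0 t)) < 1 \<and>
        (\<forall>t\<ge>0. x t + x0 t > y t + y0 t)}"

end

theory Submission
  imports Defs
begin

text \<open>
  The other particle repels, so \<open>X\<close> is convex and \<open>Y\<close> is concave after \<open>T\<^sup>+\<close>; hence
  \<open>X' \<ge> X' 0\<close>, \<open>Y' \<le> Y' T\<^sup>+\<close>, and the relative velocity is nondecreasing after
  \<open>T\<^sup>+\<close>. For small \<open>\<lambda>\<close> the pair is no worse than the reference trajectories, up to
  \<open>O(\<lambda>)\<close>. For \<open>\<lambda>\<close> bounded away from \<open>0\<close>, up to a time of closest approach (or as long as the
  relative velocity is small) the velocities are bounded away from the speed of light, so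
  the force is at least a constant times the inverse square of the distance, while the momentum
  it transfers is bounded. This bounds the minimal distance from below, and bounds the time
  after which the particles separate at a definite speed. So the distance grows linearly.

  The upper bound on \<open>X'\<close> has to cope with the factor \<open>1 / (1 + Y')\<close> at the advanced time
  \<open>a(t)\<close>. Since \<open>a' = (1 + X') / (1 + Y'(a))\<close>, this factor is absorbed by estimating
  \<open>P + sqrt (1 + P\<^sup>2)\<close> instead of the momentum \<open>P\<close>: its derivative is \<open>(1 + X') P'\<close>, and the
  advanced part of it is integrable in the variable \<open>a\<close>. The bounds for \<open>Y\<close> follow by the
  reflection \<open>(X, Y) \<mapsto> (-Y, -X)\<close>, and the force bounds then give the accelerations.
\<close>

section \<open>Momentum and velocity\<close>

text \<open>Relativistic momentum per unit mass and the velocity belonging to it, the speed of light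
  being 1. \<open>mom\<close> has this meaning only for \<open>|v| < 1\<close>.\<close>

definition mom :: "real \<Rightarrow> real" where "mom v = v / sqrt (1 - v^2)"
definition vel :: "real \<Rightarrow> real" where "vel p = p / sqrt (1 + p^2)"

lemma one_plus_sq_pos: "1 + (p::real)^2 > 0"
  by (smt (verit) zero_le_power2)

lemma one_minus_sq_pos: "\<bar>v::real\<bar> < 1 \<Longrightarrow> 1 - v^2 > 0"
  by (simp add: abs_square_less_1)

lemma vel_mom: "\<bar>v\<bar> < 1 \<Longrightarrow> vel (mom v) = v"
proof -
  assume "\<bar>v\<bar> < 1"
  then have p: "1 - v^2 > 0" by (rule one_minus_sq_pos)
  have "1 + (mom v)^2 = 1 / (1 - v^2)"
    using p by (simp add: mom_def power_divide field_simps)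
  then have "sqrt (1 + (mom v)^2) = 1 / sqrt (1 - v^2)"
    by (simp add: real_sqrt_divide)
  then show ?thesis using p by (simp add: vel_def) (simp add: mom_def)
qed

lemma mom_vel: "mom (vel p) = p"
proof -
  have p: "1 + p^2 > 0" by (rule one_plus_sq_pos)
  have "1 - (vel p)^2 = 1 / (1 + p^2)"
    using p by (simp add: vel_def power_divide field_simps)
  then have "sqrt (1 - (vel p)^2) = 1 / sqrt (1 + p^2)"
    by (simp add: real_sqrt_divide)
  then show ?thesis using p by (simp add: mom_def) (simp add: vel_def)
qed

lemma abs_vel_less_1: "\<bar>vel p\<bar> < 1"
proof -
  have "\<bar>p\<bar> < sqrt (1 + p^2)"
    by (rule real_less_rsqrt) simp
  then have "\<bar>p\<bar> / sqrt (1 + p^2) < 1"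
    using one_plus_sq_pos[of p] by (subst divide_less_eq_1_pos) auto
  then show ?thesis
    by (simp add: vel_def abs_divide)
qed

lemma vel_minus: "vel (- p) = - vel p"
  by (simp add: vel_def)

lemma mom_minus: "mom (- p) = - mom p"
  by (simp add: mom_def)

lemma mom_nonneg: "0 \<le> v \<Longrightarrow> v < 1 \<Longrightarrow> 0 \<le> mom v"
  by (simp add: mom_def abs_square_le_1)

lemma has_real_derivative_vel:
  "(vel has_real_derivative 1 / ((1 + p^2) * sqrt (1 + p^2))) (at p within S)"
proof -
  have p: "1 + p^2 > 0" by (rule one_plus_sq_pos)
  have s: "sqrt (1 + p^2) * sqrt (1 + p^2) = 1 + p^2" "sqrt (1 + p^2) > 0" using p by auto
  show ?thesis
    unfolding vel_def[abs_def]
    apply (rule derivative_eq_intros refl | (use p s in simp; fail))+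
    using p s by (simp add: field_simps power2_eq_square)
qed

lemma has_real_derivative_mom:
  assumes "\<bar>v\<bar> < 1"
  shows "(mom has_real_derivative 1 / ((1 - v^2) * sqrt (1 - v^2))) (at v within S)"
proof -
  have p: "1 - v^2 > 0" using assms by (rule one_minus_sq_pos)
  have s: "sqrt (1 - v^2) * sqrt (1 - v^2) = 1 - v^2" "sqrt (1 - v^2) > 0" using p by auto
  show ?thesis
    unfolding mom_def[abs_def]
    apply (rule derivative_eq_intros refl | (use p s in simp; fail))+
    using p s by (simp add: field_simps power2_eq_square)
qed

text \<open>Along a motion this makes momentum plus energy change at the rate
  \<open>(1 + U') P'\<close>, on which the upper velocity bound rests.\<close>

lemma has_real_derivative_energy:
  "((\<lambda>p. sqrt (1 + p^2)) has_real_derivative vel p) (at p within S)"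
  by (rule derivative_eq_intros refl | (use one_plus_sq_pos[of p] in simp; fail))+
    (use one_plus_sq_pos[of p] in \<open>simp_all add: vel_def field_simps\<close>)

lemma vel_mono: "p \<le> p' \<Longrightarrow> vel p \<le> vel p'"
  by (rule DERIV_nonneg_imp_nondecreasing) (use has_real_derivative_vel one_plus_sq_pos in force)+

lemma vel_less_1: "vel p < 1" and vel_gt_m1: "vel p > -1"
  using abs_vel_less_1[of p] by auto

text \<open>\<open>vel\<close> has slope \<open>(1 + p^2)^(-3/2) <= 1\<close>; a momentum loss of
  order \<open>l\<close> thus costs a velocity of order \<open>l\<close> at most.\<close>

lemma vel_diff_le: "p \<le> p' \<Longrightarrow> vel p' - vel p \<le> p' - p"
proof -
  assume le: "p \<le> p'"
  have "p - vel p \<le> p' - vel p'"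
  proof (rule DERIV_nonneg_imp_nondecreasing[OF le])
    fix x :: real
    have "1 / ((1 + x^2) * sqrt (1 + x^2)) \<le> 1"
      using mult_mono[of 1 "1 + x^2" 1 "sqrt (1 + x^2)"] one_plus_sq_pos[of x] by simp
    then show "\<exists>y. ((\<lambda>a. a - vel a) has_real_derivative y) (at x) \<and> 0 \<le> y"
      by (intro exI[of _ "1 - 1 / ((1 + x^2) * sqrt (1 + x^2))"] conjI derivative_intros
          has_real_derivative_vel) auto
  qed
  then show ?thesis by simp
qed

lemma mom_mono: "\<lbrakk>-1 < v; v \<le> v'; v' < 1\<rbrakk> \<Longrightarrow> mom v \<le> mom v'"
proof (rule DERIV_nonneg_imp_nondecreasing[of v v'])
  fix x assume "-1 < v" "v' < 1" "v \<le> x" "x \<le> v'"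
  then have "\<bar>x\<bar> < 1" by auto
  with has_real_derivative_mom[OF this] one_minus_sq_pos[OF this]
  show "\<exists>y. (mom has_real_derivative y) (at x) \<and> 0 \<le> y" by force
qed

lemma le_mom_of_vel_le:
  assumes "vel p \<le> v" "v < 1" shows "p \<le> mom v"
  using mom_mono[of "vel p" v] assms by (simp add: mom_vel vel_gt_m1)

lemma continuous_on_vel [continuous_intros]:
  "continuous_on S f \<Longrightarrow> continuous_on S (\<lambda>x. vel (f x))"
  unfolding vel_def
  by (intro continuous_intros) (use one_plus_sq_pos in \<open>auto simp: less_imp_neq[symmetric]\<close>)

lemma continuous_on_mom:
  "continuous_on S f \<Longrightarrow> (\<And>x. x \<in> S \<Longrightarrow> \<bar>f x\<bar> < 1) \<Longrightarrow> continuous_on S (\<lambda>x. mom (f x))"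
  unfolding mom_def
  by (intro continuous_intros) (fastforce simp: abs_square_eq_1)+

section \<open>Calculus on half-lines\<close>

lemma DERIV_reciprocal:
  fixes f :: "real \<Rightarrow> real"
  assumes "(f has_real_derivative f') (at x)" "f x \<noteq> 0"
  shows "((\<lambda>z. c / f z) has_real_derivative - (c * f' / (f x)^2)) (at x)"
  by (rule derivative_eq_intros assms refl)+ (simp add: power2_eq_square)

lemma at_within_atLeast: "u < t \<Longrightarrow> at t within {u::real..} = at t"
  by (rule at_within_interior) (auto simp: interior_real_atLeast)

lemma at_within_greaterThan: "u < t \<Longrightarrow> at t within {u::real<..} = at t"
  by (rule at_within_open) auto

text \<open>Slopes are compared only inside \<open>]s, t[\<close>, which avoids the one-sided
  derivative at \<open>u\<close>. Subtracting a linear function reduces both claims to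
  monotonicity.\<close>

lemma
  fixes f :: "real \<Rightarrow> real"
  assumes der: "\<And>t. t \<ge> u \<Longrightarrow> (f has_real_derivative f' t) (at t within {u..})"
    and st: "u \<le> s" "s \<le> t"
  shows lower_difference: "(\<And>x. s < x \<Longrightarrow> x < t \<Longrightarrow> c \<le> f' x) \<Longrightarrow> c * (t - s) \<le> f t - f s"
    and upper_difference: "(\<And>x. s < x \<Longrightarrow> x < t \<Longrightarrow> f' x \<le> c) \<Longrightarrow> f t - f s \<le> c * (t - s)"
proof -
  have cont: "continuous_on {s..t} f"
    using DERIV_continuous_on[of "{u..}" f f'] der st by (auto intro: continuous_on_subset)
  have d: "(f has_real_derivative f' x) (at x)" if "s < x" for x
    using der[of x] that st at_within_atLeast[of u x] by simp
  show "c * (t - s) \<le> f t - f s" if "\<And>x. s < x \<Longrightarrow> x < t \<Longrightarrow> c \<le> f' x"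
  proof -
    have "f s - c * s \<le> f t - c * t"
      by (rule DERIV_nonneg_imp_increasing_open[OF st(2)])
        (use that d in \<open>force intro!: derivative_eq_intros\<close>,
          auto intro!: continuous_intros cont)
    then show ?thesis by (simp add: algebra_simps)
  qed
  show "f t - f s \<le> c * (t - s)" if "\<And>x. s < x \<Longrightarrow> x < t \<Longrightarrow> f' x \<le> c"
  proof -
    have "c * s - f s \<le> c * t - f t"
      by (rule DERIV_nonneg_imp_increasing_open[OF st(2)])
        (use that d in \<open>force intro!: derivative_eq_intros\<close>,
          auto intro!: continuous_intros cont)
    then show ?thesis by (simp add: algebra_simps)
  qed
qed

lemma has_real_derivative_integral:
  fixes f :: "real \<Rightarrow> real"
  assumes "continuous_on {u..} f" "u \<le> t"
  shows "((\<lambda>t. integral {u..t} f) has_real_derivative f t) (at t within {u..})"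
proof -
  have "((\<lambda>t. integral {u..t} f) has_real_derivative f t) (at t within {u..t+1})"
    by (rule integral_has_real_derivative) (use assms in \<open>auto intro: continuous_on_subset\<close>)
  moreover have "at t within {u..} = at t within {u..t+1}"
  proof (rule at_within_nhd[of _ "{t-1<..<t+1}"])
    show "{u..} \<inter> {t - 1<..<t + 1} - {t} = {u..t + 1} \<inter> {t - 1<..<t + 1} - {t}" by auto
  qed auto
  ultimately show ?thesis by simp
qed

section \<open>Advanced and retarded times\<close>

lemma dot_on_eqI:
  assumes "(f has_real_derivative D) (at t within S)" "at t within S \<noteq> bot"
  shows "dot_on S f t = D"
  unfolding dot_on_def
  using assms by (intro vector_derivative_within)
    (auto simp: has_real_derivative_iff_has_vector_derivative)

lemma at_within_atLeast_neq_bot: "u \<le> t \<Longrightarrow> at t within {u::real..} \<noteq> bot"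
  by (cases "u = t") (auto simp: at_within_Ici_at_right at_within_atLeast)

text \<open>
  \<open>U\<close>, followed from time \<open>u\<close> on, feels \<open>W\<close>, known from time \<open>w\<close> on. The
  instances are \<open>(0, T\<^sup>-, X, Y)\<close> and \<open>(T\<^sup>+, 0, -Y, -X)\<close>.
\<close>

locale delay =
  fixes u w q :: real and U W U' W' :: "real \<Rightarrow> real"
  assumes w_le_u: "w \<le> u" and q_less_1: "q < 1"
    and U_deriv: "t \<ge> u \<Longrightarrow> (U has_real_derivative U' t) (at t within {u..})"
    and W_deriv: "t \<ge> w \<Longrightarrow> (W has_real_derivative W' t) (at t within {w..})"
    and abs_U'_le: "t \<ge> u \<Longrightarrow> \<bar>U' t\<bar> \<le> q"
    and abs_W'_le: "t \<ge> w \<Longrightarrow> \<bar>W' t\<bar> \<le> q"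
    and W'_cont: "continuous_on {w..} W'"
    and W_less_U: "t \<ge> u \<Longrightarrow> W t < U t"
    and lightlike: "U u - W w = u - w"
begin

lemma q_nonneg: "0 \<le> q"
  using abs_W'_le[of w] by simp

lemma W_cont: "continuous_on {w..} W"
  by (rule DERIV_continuous_on[of _ _ W']) (use W_deriv in auto)

lemma U_lipschitz: "u \<le> s \<Longrightarrow> s \<le> t \<Longrightarrow> \<bar>U t - U s\<bar> \<le> q * (t - s)"
  using lower_difference[OF U_deriv, of s t "-q"] upper_difference[OF U_deriv, of s t q]
  by (smt (verit) abs_U'_le minus_mult_left)

lemma W_lipschitz: "w \<le> s \<Longrightarrow> s \<le> t \<Longrightarrow> \<bar>W t - W s\<bar> \<le> q * (t - s)"
  using lower_difference[OF W_deriv, of s t "-q"] upper_difference[OF W_deriv, of s t q]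
  by (smt (verit) abs_W'_le minus_mult_left)

lemma W_lipschitz_abs: "w \<le> s \<Longrightarrow> w \<le> t \<Longrightarrow> \<bar>W t - W s\<bar> \<le> q * \<bar>t - s\<bar>"
  using W_lipschitz[of s t] W_lipschitz[of t s] by (cases "s \<le> t") auto

text \<open>The \<open>t2\<close> operators serve both instances: under the reflection they become
  the \<open>t1\<close> operators of the original pair, because only the absolute distance
  enters.\<close>

definition ret :: "real \<Rightarrow> real" where "ret t = t2_ret w U W t"
definition adv :: "real \<Rightarrow> real" where "adv t = t2_adv w U W t"

text \<open>\<open>W\<close> is \<open>q\<close>-Lipschitz, so two solutions differ by at most
  \<open>q < 1\<close> times their own difference. The same holds for the advanced time.\<close>

lemma ret_unique:
  assumes "w \<le> s" "s = t - \<bar>U t - W s\<bar>" "w \<le> s'" "s' = t - \<bar>U t - W s'\<bar>"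
  shows "s = s'"
proof -
  have "\<bar>s - s'\<bar> \<le> \<bar>W s - W s'\<bar>" using assms(2,4) by linarith
  also have "\<dots> \<le> q * \<bar>s - s'\<bar>" using W_lipschitz_abs assms by blast
  finally have "(1 - q) * \<bar>s - s'\<bar> \<le> 0" by (simp add: algebra_simps)
  then show ?thesis using q_less_1 by (simp add: mult_le_0_iff)
qed

lemma adv_unique:
  assumes "w \<le> s" "s = t + \<bar>U t - W s\<bar>" "w \<le> s'" "s' = t + \<bar>U t - W s'\<bar>"
  shows "s = s'"
proof -
  have "\<bar>s - s'\<bar> \<le> \<bar>W s - W s'\<bar>" using assms(2,4) by linarith
  also have "\<dots> \<le> q * \<bar>s - s'\<bar>" using W_lipschitz_abs assms by blast
  finally have "(1 - q) * \<bar>s - s'\<bar> \<le> 0" by (simp add: algebra_simps)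
  then show ?thesis using q_less_1 by (simp add: mult_le_0_iff)
qed

lemma mult_q_le: "0 \<le> x \<Longrightarrow> q * x \<le> x"
  using q_less_1 by (simp add: mult_left_le_one_le q_nonneg)

text \<open>Intermediate value theorem for \<open>s - W s\<close> on \<open>{w..t}\<close>.\<close>

lemma ret_exists:
  assumes t: "u \<le> t"
  obtains s where "w \<le> s" "s \<le> t" "s = t - (U t - W s)"
proof -
  have "\<bar>U t - U u\<bar> \<le> t - u" using U_lipschitz[of u t] mult_q_le[of "t - u"] t by linarith
  \<comment> \<open>The light ray leaving \<open>W\<close> at time \<open>w\<close> meets
    \<open>U\<close> exactly at \<open>u\<close>. As \<open>U\<close> is slower than light, the rays
    that meet it later start after \<open>w\<close>, where \<open>W\<close> is known.\<close>
  then have 1: "w - W w \<le> t - U t" using lightlike by linarith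
  have 2: "t - U t \<le> t - W t" using W_less_U[OF t] by simp
  have "continuous_on {w..t} (\<lambda>s. s - W s)"
    by (intro continuous_intros continuous_on_subset[OF W_cont]) auto
  then obtain s where "w \<le> s" "s \<le> t" "s - W s = t - U t"
    using IVT'[of "\<lambda>s. s - W s" w "t - U t" t] 1 2 w_le_u t by auto
  then show thesis by (intro that[of s]) auto
qed

lemma adv_exists:
  assumes t: "u \<le> t"
  obtains s where "t \<le> s" "s = t + (U t - W s)"
proof -
  \<comment> \<open>The gap between the forward light ray and \<open>W\<close> shrinks at least at
    the rate \<open>1 - q\<close>, hence it is closed by the time \<open>b\<close>.\<close>
  define b where "b = t + (U t - W t) / (1 - q)"
  have d: "0 < U t - W t" using W_less_U[OF t] by simp
  then have tb: "t \<le> b" using q_less_1 by (simp add: b_def)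
  have "\<bar>W b - W t\<bar> \<le> q * (b - t)" using W_lipschitz[of t b] tb w_le_u t by simp
  moreover have "(1 - q) * (b - t) = U t - W t" using q_less_1 by (simp add: b_def)
  then have "b - t - q * (b - t) = U t - W t" by (simp add: algebra_simps)
  ultimately have 2: "t + U t \<le> b + W b" by linarith
  have 1: "t + W t \<le> t + U t" using d by simp
  have "continuous_on {t..b} (\<lambda>s. s + W s)"
    by (intro continuous_intros continuous_on_subset[OF W_cont]) (use w_le_u t in auto)
  then obtain s where "t \<le> s" "s \<le> b" "s + W s = t + U t"
    using IVT'[of "\<lambda>s. s + W s" t "t + U t" b] 1 2 tb by auto
  then show thesis by (intro that[of s]) auto
qed

lemma
  assumes t: "u \<le> t"
  shows w_le_ret: "w \<le> ret t" and ret_eq: "U t - W (ret t) = t - ret t"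
    and ret_less: "ret t < t"
proof -
  obtain s where s: "w \<le> s" "s \<le> t" "s = t - (U t - W s)" using ret_exists[OF t] .
  then have abs: "s = t - \<bar>U t - W s\<bar>" by linarith
  have "ret t = s"
    unfolding ret_def t2_ret_def
    by (rule the_equality) (use s(1) abs ret_unique[of _ t s] in blast)+
  moreover have "s \<noteq> t"
  proof
    assume "s = t"
    then show False using s(3) W_less_U[OF t] by simp
  qed
  moreover have "U t - W s = t - s" using s(3) by linarith
  ultimately show "w \<le> ret t" "U t - W (ret t) = t - ret t" "ret t < t"
    using s(1,2) by simp_all
qed

lemma
  assumes t: "u \<le> t"
  shows adv_eq: "U t - W (adv t) = adv t - t" and less_adv: "t < adv t"
proof -
  obtain s where s: "t \<le> s" "s = t + (U t - W s)" using adv_exists[OF t] .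
  then have abs: "s = t + \<bar>U t - W s\<bar>" by linarith
  have "w \<le> s" using s(1) t w_le_u by linarith
  then have "adv t = s"
    unfolding adv_def t2_adv_def
    by (intro the_equality) (use abs adv_unique[of _ t s] in blast)+
  moreover have "s \<noteq> t"
  proof
    assume "s = t"
    then show False using s(2) W_less_U[OF t] by simp
  qed
  moreover have "U t - W s = s - t" using s(2) by linarith
  ultimately show "U t - W (adv t) = adv t - t" "t < adv t"
    using s(1) by simp_all
qed

lemma w_le_adv: "u \<le> t \<Longrightarrow> w \<le> adv t"
  using less_adv[of t] w_le_u by simp

text \<open>One estimate for both times, which solve \<open>s + e W s = t + e U t\<close> with
  \<open>e = -1\<close> (retarded) and \<open>e = 1\<close> (advanced). The left side grows at least
  at the rate \<open>1 - q\<close>, the right side changes at most at the rate 2.\<close>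

lemma lipschitz_inverse:
  assumes "w \<le> s" "w \<le> s'" "\<bar>e\<bar> = 1" "s - s' + e * (W s - W s') = t - t' + e * (U t - U t')"
    "u \<le> t" "u \<le> t'"
  shows "\<bar>s - s'\<bar> \<le> 2 / (1 - q) * \<bar>t - t'\<bar>"
proof -
  have W: "\<bar>e * (W s - W s')\<bar> \<le> q * \<bar>s - s'\<bar>"
    using assms W_lipschitz_abs by (simp add: abs_mult)
  have "\<bar>U t - U t'\<bar> \<le> q * \<bar>t - t'\<bar>"
    using assms U_lipschitz[of t t'] U_lipschitz[of t' t] by (cases "t \<le> t'") auto
  then have U: "\<bar>e * (U t - U t')\<bar> \<le> \<bar>t - t'\<bar>"
    using assms mult_q_le[of "\<bar>t - t'\<bar>"] by (simp add: abs_mult)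
  have "(1 - q) * \<bar>s - s'\<bar> \<le> 2 * \<bar>t - t'\<bar>"
  proof -
    have "s - s' = (t - t') + e * (U t - U t') - e * (W s - W s')" using assms(4) by simp
    also have "\<bar>\<dots>\<bar> \<le> \<bar>t - t'\<bar> + \<bar>e * (U t - U t')\<bar> + \<bar>e * (W s - W s')\<bar>"
      by (rule order_trans[OF abs_triangle_ineq4 add_right_mono[OF abs_triangle_ineq]])
    finally have "\<bar>s - s'\<bar> \<le> q * \<bar>s - s'\<bar> + 2 * \<bar>t - t'\<bar>"
      using W U by simp
    then show ?thesis by (simp add: algebra_simps)
  qed
  then show ?thesis using q_less_1 by (simp add: field_simps)
qed

lemma ret_lipschitz: "u \<le> t \<Longrightarrow> u \<le> t' \<Longrightarrow> \<bar>ret t - ret t'\<bar> \<le> 2 / (1 - q) * \<bar>t - t'\<bar>"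
  using ret_eq[of t] ret_eq[of t']
  by (intro lipschitz_inverse[where e = "-1"]) (auto simp: w_le_ret)

lemma adv_lipschitz: "u \<le> t \<Longrightarrow> u \<le> t' \<Longrightarrow> \<bar>adv t - adv t'\<bar> \<le> 2 / (1 - q) * \<bar>t - t'\<bar>"
  using adv_eq[of t] adv_eq[of t']
  by (intro lipschitz_inverse[where e = 1]) (auto simp: w_le_adv)

lemma ret_cont: "continuous_on {u..} ret"
  by (rule lipschitz_on_continuous_on[of "2 / (1 - q)"], rule lipschitz_onI)
    (use q_less_1 ret_lipschitz in \<open>auto simp: dist_real_def\<close>)

lemma adv_cont: "continuous_on {u..} adv"
  by (rule lipschitz_on_continuous_on[of "2 / (1 - q)"], rule lipschitz_onI)
    (use q_less_1 adv_lipschitz in \<open>auto simp: dist_real_def\<close>)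

lemma W'_cont_ret: "continuous_on {u..} (\<lambda>t. W' (ret t))"
  by (rule continuous_on_compose2[OF W'_cont ret_cont]) (auto simp: w_le_ret)

lemma W'_cont_adv: "continuous_on {u..} (\<lambda>t. W' (adv t))"
  by (rule continuous_on_compose2[OF W'_cont adv_cont]) (auto simp: w_le_adv)

lemma abs_W'_less_1: "w \<le> t \<Longrightarrow> -1 < W' t \<and> W' t < 1"
  using abs_W'_le[of t] q_less_1 by auto

lemma abs_U'_less_1: "u \<le> t \<Longrightarrow> -1 < U' t \<and> U' t < 1"
  using abs_U'_le[of t] q_less_1 by auto

text \<open>Implicit differentiation of \<open>adv t + W (adv t) = t + U t\<close>. Beforehand
  \<open>adv\<close> is only known to be continuous, which is enough when the increments of
  \<open>U\<close> and \<open>W\<close> are written with Caratheodory slopes.\<close>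

lemma adv_deriv:
  assumes t: "u < t"
  shows "(adv has_real_derivative (1 + U' t) / (1 + W' (adv t))) (at t)"
proof -
  have Ud: "(U has_real_derivative U' t) (at t)"
    using U_deriv[of t] t by (simp add: at_within_atLeast)
  have Wd: "(W has_real_derivative W' (adv t)) (at (adv t))"
    using W_deriv[of "adv t"] less_adv[of t] t w_le_u by (simp add: at_within_atLeast)
  have pos: "0 < 1 + W' (adv t)" using abs_W'_less_1[of "adv t"] w_le_adv[of t] t by simp
  have ac: "isCont adv t"
    using adv_cont t at_within_atLeast[OF t]
    unfolding continuous_on_eq_continuous_within by (metis atLeast_iff less_imp_le)
  obtain g where g: "\<And>z. W z - W (adv t) = g z * (z - adv t)" "isCont g (adv t)"
      "g (adv t) = W' (adv t)"
    using Wd unfolding CARAT_DERIV by blast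
  obtain h where h: "\<And>z. U z - U t = h z * (z - t)" "isCont h t" "h t = U' t"
    using Ud unfolding CARAT_DERIV by blast
  have gc: "isCont (\<lambda>z. g (adv z)) t" using ac g(2) by (rule isCont_o2)
  have "((\<lambda>z. (1 + h z) / (1 + g (adv z))) \<longlongrightarrow> (1 + h t) / (1 + g (adv t))) (at t)"
    using gc h(2) pos g(3) unfolding isCont_def by (intro tendsto_intros) auto
  \<comment> \<open>Subtracting the equations at \<open>z\<close> and \<open>t\<close> gives the
    difference quotient of \<open>adv\<close> in closed form wherever \<open>1 + g (adv z)\<close>
    is positive, that is, near \<open>t\<close>.\<close>
  moreover have "\<forall>\<^sub>F z in at t. (1 + h z) / (1 + g (adv z)) = (adv z - adv t) / (z - t)"
  proof -
    have "\<forall>\<^sub>F z in at t. 0 < 1 + g (adv z)"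
      using gc pos g(3) unfolding isCont_def
      by (intro order_tendstoD(1)[where y = "1 + g (adv t)"] tendsto_intros) auto
    moreover have "\<forall>\<^sub>F z in at t. z \<noteq> t" by (simp add: eventually_at_filter)
    moreover have "\<forall>\<^sub>F z in at t. u < z"
      using t by (simp add: order_tendstoD(1)[OF tendsto_ident_at])
    ultimately show ?thesis
    proof (eventually_elim)
      case (elim z)
      have "adv z - adv t + (W (adv z) - W (adv t)) = z - t + (U z - U t)"
        using adv_eq[of z] adv_eq[of t] elim t by simp
      then have "(adv z - adv t) * (1 + g (adv z)) = (1 + h z) * (z - t)"
        unfolding g(1) h(1) by (simp add: algebra_simps)
      then show ?case using elim by (simp add: frac_eq_eq)
    qed
  qed
  ultimately show ?thesis
    unfolding has_field_derivative_iff g(3)[symmetric] h(3)[symmetric]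
    by (rule Lim_transform_eventually)
qed

section \<open>Bounds for the force\<close>

text \<open>Along a light ray the distance equals the delay, so the squared distances turn into
  squared delays.\<close>

lemma F1_eq:
  assumes t: "u \<le> t"
  shows "F1 w U W t = (1 + W' (ret t)) / (1 - W' (ret t)) * (1 / (t - ret t)^2)
    + (1 - W' (adv t)) / (1 + W' (adv t)) * (1 / (adv t - t)^2)"
proof -
  have "dot_on {w..} W s = W' s" if "w \<le> s" for s
    using W_deriv[OF that] at_within_atLeast_neq_bot[OF that] by (rule dot_on_eqI)
  then show ?thesis
    unfolding F1_def Let_def ret_def[symmetric] adv_def[symmetric]
    using t by (simp add: w_le_ret w_le_adv ret_eq adv_eq)
qed

lemma F1_cont: "continuous_on {u..} (F1 w U W)"
proof -
  have ne: "\<forall>t\<in>{u..}. 1 - W' (ret t) \<noteq> 0" "\<forall>t\<in>{u..}. 1 + W' (adv t) \<noteq> 0"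
    using abs_W'_less_1[OF w_le_ret] abs_W'_less_1[OF w_le_adv] by fastforce+
  have ne': "\<forall>t\<in>{u..}. (t - ret t)^2 \<noteq> 0" "\<forall>t\<in>{u..}. (adv t - t)^2 \<noteq> 0"
    using ret_less less_adv by force+
  have "continuous_on {u..} (\<lambda>t. (1 + W' (ret t)) / (1 - W' (ret t)) * (1 / (t - ret t)^2)
    + (1 - W' (adv t)) / (1 + W' (adv t)) * (1 / (adv t - t)^2))"
    by (intro continuous_intros W'_cont_ret W'_cont_adv ret_cont adv_cont ne ne')
  then show ?thesis
    by (rule continuous_on_eq) (simp add: F1_eq)
qed

lemma F1_nonneg:
  assumes t: "u \<le> t"
  shows "0 \<le> F1 w U W t"
proof -
  have "0 \<le> (1 + W' (ret t)) / (1 - W' (ret t))" "0 \<le> (1 - W' (adv t)) / (1 + W' (adv t))"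
    using abs_W'_less_1[OF w_le_ret[OF t]] abs_W'_less_1[OF w_le_adv[OF t]] by auto
  then show ?thesis
    unfolding F1_eq[OF t] by (intro add_nonneg_nonneg mult_nonneg_nonneg) auto
qed

text \<open>During a delay \<open>x\<close> a particle moves by at most \<open>x\<close>, so the
  light ray distance \<open>x\<close> becomes at most \<open>2 x\<close> at equal times. The third
  bound moves \<open>U\<close> instead of \<open>W\<close>: it refers the advanced delay to the
  distance at the advanced time, as needed for integrating in the variable
  \<open>adv t\<close>.\<close>

lemma delay_ge_half:
  assumes t: "u \<le> t"
  shows "(U t - W t) / 2 \<le> t - ret t" "(U t - W t) / 2 \<le> adv t - t"
    "(U (adv t) - W (adv t)) / 2 \<le> adv t - t"
proof -
  have *: "(a - b) / 2 \<le> x" if "\<bar>c - d\<bar> \<le> q * x" "a - b = x + (c - d) \<or> a - b = x - (c - d)" "0 \<le> x"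
    for a b c d x :: real
  proof -
    have "\<bar>c - d\<bar> \<le> x" using that(1) mult_q_le[OF that(3)] by simp
    then show ?thesis using that(2) by (simp add: abs_le_iff) linarith
  qed
  note r = less_imp_le[OF ret_less[OF t]] and a = less_imp_le[OF less_adv[OF t]]
  show "(U t - W t) / 2 \<le> t - ret t"
    by (rule *[OF W_lipschitz[OF w_le_ret[OF t] r]]) (use ret_eq[OF t] r in auto)
  show "(U t - W t) / 2 \<le> adv t - t"
    by (rule *[OF W_lipschitz[OF order_trans[OF w_le_u t] a]]) (use adv_eq[OF t] a in auto)
  show "(U (adv t) - W (adv t)) / 2 \<le> adv t - t"
    by (rule *[OF U_lipschitz[OF t a]]) (use adv_eq[OF t] a in auto)
qed

text \<open>During the delay \<open>W\<close> makes up at most the fraction \<open>b\<close> of the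
  light path. It is applied with \<open>b = \<beta>\<close>, which does not depend on the solution
  as \<open>q\<close> does.\<close>

lemma delay_le:
  assumes t: "u \<le> t" and b: "\<And>s. w \<le> s \<Longrightarrow> W' s \<le> b" "b < 1"
  shows "t - ret t \<le> (U t - W t) / (1 - b)"
proof -
  have "W t - W (ret t) \<le> b * (t - ret t)"
    by (rule upper_difference[OF W_deriv]) (use w_le_ret[OF t] ret_less[OF t] b in auto)
  then have "(1 - b) * (t - ret t) \<le> U t - W t" using ret_eq[OF t] by (simp add: algebra_simps)
  then show ?thesis using b by (simp add: field_simps)
qed

text \<open>The retarded term alone gives the bound and the nonnegative advanced one is dropped;
  hence the lower bound on \<open>W'\<close> is asked for only up to the present time.\<close>

lemma F1_lower:
  assumes t: "u \<le> t" and b: "\<And>s. w \<le> s \<Longrightarrow> W' s \<le> b" "b < 1"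
    and v: "\<And>s. w \<le> s \<Longrightarrow> s \<le> t \<Longrightarrow> - v \<le> W' s" "v < 1"
  shows "(1 - v) / 2 * (1 - b)^2 / (U t - W t)^2 \<le> F1 w U W t"
proof -
  let ?r = "W' (ret t)"
  have r: "- v \<le> ?r" "-1 < ?r" "?r < 1" using v w_le_ret[OF t] ret_less[OF t] abs_W'_less_1[of "ret t"] by auto
  have d: "0 < U t - W t" using W_less_U[OF t] by simp
  have "(1 - b)^2 / (U t - W t)^2 = 1 / ((U t - W t) / (1 - b))^2"
    by (simp add: power_divide)
  also have "\<dots> \<le> 1 / (t - ret t)^2"
    using delay_le[OF t b] ret_less[OF t] by (intro divide_left_mono power_mono mult_pos_pos) (use d b in auto)
  finally have 1: "(1 - b)^2 / (U t - W t)^2 \<le> 1 / (t - ret t)^2" .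
  have "(1 - v) / 2 \<le> (1 + ?r) / (1 - ?r)"
    using r v by (intro frac_le) auto
  then have "(1 - v) / 2 * ((1 - b)^2 / (U t - W t)^2) \<le> (1 + ?r) / (1 - ?r) * (1 / (t - ret t)^2)"
    using r v 1 by (intro mult_mono) auto
  also have "\<dots> \<le> F1 w U W t"
    using abs_W'_less_1[OF w_le_adv[OF t]] by (simp add: F1_eq[OF t])
  finally show ?thesis by simp
qed

lemma F1_upper:
  assumes t: "u \<le> t" and V: "\<And>s. w \<le> s \<Longrightarrow> \<bar>W' s\<bar> \<le> V" "V < 1"
  shows "F1 w U W t \<le> 16 / ((1 - V) * (U t - W t)^2)"
proof -
  have d: "0 < U t - W t" using W_less_U[OF t] by simp
  have inv: "1 / x^2 \<le> 4 / (U t - W t)^2" if "(U t - W t) / 2 \<le> x" for x :: real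
  proof -
    have "1 / x^2 \<le> 1 / ((U t - W t) / 2)^2"
      using that d by (intro divide_left_mono power_mono mult_pos_pos) auto
    then show ?thesis by (simp add: power_divide)
  qed
  let ?r = "W' (ret t)" and ?a = "W' (adv t)"
  have r: "\<bar>?r\<bar> \<le> V" "\<bar>?a\<bar> \<le> V" using V w_le_ret[OF t] w_le_adv[OF t] by auto
  have "(1 + ?r) / (1 - ?r) \<le> 2 / (1 - V)" "(1 - ?a) / (1 + ?a) \<le> 2 / (1 - V)"
    using r V by (intro frac_le; simp)+
  note mono = this
  have "(1 + ?r) / (1 - ?r) * (1 / (t - ret t)^2) \<le> 2 / (1 - V) * (4 / (U t - W t)^2)"
    by (rule mult_mono[OF mono(1) inv[OF delay_ge_half(1)[OF t]]]) (use V in auto)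
  moreover have "(1 - ?a) / (1 + ?a) * (1 / (adv t - t)^2) \<le> 2 / (1 - V) * (4 / (U t - W t)^2)"
    by (rule mult_mono[OF mono(2) inv[OF delay_ge_half(2)[OF t]]]) (use V in auto)
  ultimately have "F1 w U W t \<le> 2 / (1 - V) * (4 / (U t - W t)^2) + 2 / (1 - V) * (4 / (U t - W t)^2)"
    unfolding F1_eq[OF t] by linarith
  then show ?thesis by simp
qed

end

section \<open>The motion of one particle\<close>

text \<open>Common form of \<open>P1\<close> and, after the reflection, of \<open>- P2\<close>. Here
  \<open>g\<close> is the reference velocity, and \<open>g u\<close> is the prescribed initial
  velocity.\<close>

definition momentum :: "real \<Rightarrow> real \<Rightarrow> (real \<Rightarrow> real) \<Rightarrow> real \<Rightarrow> (real \<Rightarrow> real) \<Rightarrow> real \<Rightarrow> real" where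
  "momentum \<kappa> l g u F t =
     (1 - l) * mom (g t) + l * mom (g u) + l * integral {u..t} (\<lambda>s. \<kappa> / 2 * F s)"

text \<open>\<open>S\<close> is where the reference acceleration is available: \<open>{0..}\<close>
  for \<open>X\<close>, but only the open half-line after \<open>Tp\<close> for the reflected
  \<open>Y\<close>. The bound \<open>\<beta>\<close> comes from the reference trajectories alone, so
  it may enter the final constants, whereas \<open>q\<close> belongs to one solution.\<close>

locale driven = delay +
  fixes \<kappa> l \<beta> :: real and g g' :: "real \<Rightarrow> real" and S :: "real set"
  assumes u_nonneg: "0 \<le> u" and \<kappa>_pos: "0 < \<kappa>" and l_nonneg: "0 \<le> l" and l_le_1: "l \<le> 1"
    and \<beta>_less_1: "\<beta> < 1"
    and S: "{u<..} \<subseteq> S" "S \<subseteq> {u..}"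
    and g_cont: "continuous_on {u..} g"
    and g_deriv: "t \<in> S \<Longrightarrow> (g has_real_derivative g' t) (at t within {u..})"
    and g'_nonneg: "t \<in> S \<Longrightarrow> 0 \<le> g' t"
    and abs_g_le: "t \<ge> u \<Longrightarrow> \<bar>g t\<bar> \<le> \<beta>"
    and U_eq: "t \<ge> u \<Longrightarrow> U t = U u + integral {u..t} (\<lambda>s. vel (momentum \<kappa> l g u (F1 w U W) s))"
begin

abbreviation "P \<equiv> momentum \<kappa> l g u (F1 w U W)"

lemma \<beta>_nonneg: "0 \<le> \<beta>"
  using abs_g_le[of u] by simp

lemma abs_g_less_1: "t \<ge> u \<Longrightarrow> \<bar>g t\<bar> < 1"
  using abs_g_le[of t] \<beta>_less_1 by simp

lemma mom_g_bounds: "t \<ge> u \<Longrightarrow> - mom \<beta> \<le> mom (g t)" "t \<ge> u \<Longrightarrow> mom (g t) \<le> mom \<beta>"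
  using abs_g_le[of t] \<beta>_less_1 mom_mono[of "-\<beta>" "g t"] mom_mono[of "g t" \<beta>]
  by (auto simp: mom_minus)

lemma greaterThan_S: "u < t \<Longrightarrow> t \<in> S"
  using S by auto

lemma g_mono:
  assumes "u \<le> s" "s \<le> t"
  shows "g s \<le> g t"
proof (rule DERIV_nonneg_imp_increasing_open[OF assms(2)])
  fix x assume "s < x"
  then have x: "u < x" using assms by simp
  note Sx = greaterThan_S[OF x]
  show "\<exists>y. (g has_real_derivative y) (at x) \<and> 0 \<le> y"
    using g_deriv[OF Sx] g'_nonneg[OF Sx] at_within_atLeast[OF x] by auto
qed (use assms in \<open>auto intro: continuous_on_subset[OF g_cont]\<close>)

lemma mom_g_mono: "u \<le> s \<Longrightarrow> s \<le> t \<Longrightarrow> mom (g s) \<le> mom (g t)"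
  using g_mono[of s t] abs_g_less_1[of s] abs_g_less_1[of t] by (intro mom_mono) auto

lemma force_deriv:
  assumes "u \<le> t"
  shows "((\<lambda>t. integral {u..t} (\<lambda>s. \<kappa> / 2 * F1 w U W s)) has_real_derivative \<kappa> / 2 * F1 w U W t)
    (at t within {u..})"
  by (rule has_real_derivative_integral[OF _ assms]) (intro continuous_intros F1_cont)

lemma P_cont: "continuous_on {u..} P"
  unfolding momentum_def
  by (intro continuous_intros continuous_on_mom g_cont abs_g_less_1
      DERIV_continuous_on[OF force_deriv]) auto

text \<open>The fixed point equation is differentiated and becomes the equation of motion.\<close>

lemma U'_eq:
  assumes t: "u \<le> t"
  shows "U' t = vel (P t)"
proof -
  have "((\<lambda>t. U u + integral {u..t} (\<lambda>s. vel (P s))) has_real_derivative vel (P t)) (at t within {u..})"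
    using has_real_derivative_integral[OF continuous_on_vel[OF P_cont] t]
    by (auto intro!: derivative_eq_intros)
  then have "(U has_real_derivative vel (P t)) (at t within {u..})"
    by (rule has_field_derivative_transform_within[where d = 1])
      (use t in \<open>simp_all add: U_eq[symmetric]\<close>)
  with U_deriv[OF t] show ?thesis
    using at_within_atLeast_neq_bot[OF t] by (metis dot_on_eqI)
qed

definition mom' :: "real \<Rightarrow> real"
  where "mom' t = 1 / ((1 - (g t)^2) * sqrt (1 - (g t)^2)) * g' t"

lemma mom_g_deriv: "t \<in> S \<Longrightarrow> ((\<lambda>t. mom (g t)) has_real_derivative mom' t) (at t within {u..})"
  unfolding mom'_def
  by (rule DERIV_chain2[OF has_real_derivative_mom g_deriv]) (use S abs_g_less_1 in auto)

lemma mom'_nonneg: "t \<in> S \<Longrightarrow> 0 \<le> mom' t"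
  unfolding mom'_def using S one_minus_sq_pos[OF abs_g_less_1, of t] g'_nonneg[of t] by auto

section \<open>Evolution of the momentum\<close>

lemma P_deriv:
  assumes "t \<in> S"
  shows "(P has_real_derivative (1 - l) * mom' t + l * (\<kappa> / 2 * F1 w U W t)) (at t within {u..})"
proof -
  have "u \<le> t" using S assms by auto
  then have "((\<lambda>t. (1 - l) * mom (g t) + l * mom (g u) + l * integral {u..t} (\<lambda>s. \<kappa> / 2 * F1 w U W s))
      has_real_derivative (1 - l) * mom' t + 0 + l * (\<kappa> / 2 * F1 w U W t)) (at t within {u..})"
    by (intro DERIV_add DERIV_cmult DERIV_const mom_g_deriv assms force_deriv)
  then show ?thesis by (simp only: momentum_def[abs_def] add_0_right)
qed

lemma P_deriv_interior:
  "u < t \<Longrightarrow> (P has_real_derivative (1 - l) * mom' t + l * (\<kappa> / 2 * F1 w U W t)) (at t)"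
  using P_deriv[OF greaterThan_S, of t] at_within_atLeast[of u t] by simp

text \<open>\<open>\<Phi>\<close> is an antiderivative of a lower bound of the force. The reference
  part of the momentum only increases, so \<open>P - l * \<kappa> / 2 * \<Phi>\<close> is
  nondecreasing.\<close>

lemma momentum_gain:
  assumes st: "u \<le> s" "s \<le> t"
    and \<Phi>: "\<And>x. s < x \<Longrightarrow> x < t \<Longrightarrow> (\<Phi> has_real_derivative \<phi> x) (at x)"
    and cont: "continuous_on {s..t} \<Phi>" and le: "\<And>x. s < x \<Longrightarrow> x < t \<Longrightarrow> \<phi> x \<le> F1 w U W x"
  shows "l * \<kappa> / 2 * (\<Phi> t - \<Phi> s) \<le> P t - P s"
proof -
  have "P s - l * \<kappa> / 2 * \<Phi> s \<le> P t - l * \<kappa> / 2 * \<Phi> t"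
  proof (rule DERIV_nonneg_imp_increasing_open[OF st(2)])
    show "continuous_on {s..t} (\<lambda>x. P x - l * \<kappa> / 2 * \<Phi> x)"
      by (intro continuous_intros cont continuous_on_subset[OF P_cont]) (use st in auto)
    fix x assume x: "s < x" "x < t"
    have d: "((\<lambda>x. P x - l * \<kappa> / 2 * \<Phi> x) has_real_derivative
        (1 - l) * mom' x + l * (\<kappa> / 2 * F1 w U W x) - l * \<kappa> / 2 * \<phi> x) (at x)"
      by (intro DERIV_diff DERIV_cmult P_deriv_interior \<Phi>) (use x st in auto)
    have "l * \<kappa> / 2 * \<phi> x \<le> l * \<kappa> / 2 * F1 w U W x"
      using le[OF x] l_nonneg \<kappa>_pos by (intro mult_left_mono) auto
    moreover have "0 \<le> (1 - l) * mom' x"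
      using mom'_nonneg[OF greaterThan_S, of x] x st l_le_1 by simp
    ultimately have "0 \<le> (1 - l) * mom' x + l * (\<kappa> / 2 * F1 w U W x) - l * \<kappa> / 2 * \<phi> x"
      by simp
    with d show "\<exists>y. ((\<lambda>x. P x - l * \<kappa> / 2 * \<Phi> x) has_real_derivative y) (at x) \<and> 0 \<le> y" by blast
  qed
  then show ?thesis unfolding right_diff_distrib by linarith
qed

lemma P_mono: "u \<le> s \<Longrightarrow> s \<le> t \<Longrightarrow> P s \<le> P t"
  using momentum_gain[of s t "\<lambda>_. 0" "\<lambda>_. 0"] F1_nonneg by auto

lemma U'_mono: "u \<le> s \<Longrightarrow> s \<le> t \<Longrightarrow> U' s \<le> U' t"
  using P_mono[of s t] by (auto simp: U'_eq intro: vel_mono)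

lemma P_initial: "P u = mom (g u)"
  by (simp add: momentum_def algebra_simps)

lemma U'_initial: "U' u = g u"
  by (simp add: U'_eq P_initial vel_mom abs_g_less_1)

text \<open>The initial velocity is the same for all \<open>l\<close>, and \<open>U'\<close>
  increases. This bound holds without any knowledge of the distance.\<close>

lemma U'_ge: "u \<le> t \<Longrightarrow> - \<beta> \<le> U' t"
  using U'_mono[of u t] abs_g_le[of u] by (auto simp: U'_initial)

text \<open>A particle that is still slow at time \<open>t\<close> cannot have received much
  momentum. This limits how close the particles come and how long they stay close.\<close>

lemma momentum_gain_le:
  assumes "u \<le> s" "s \<le> t"
    and "\<And>x. s < x \<Longrightarrow> x < t \<Longrightarrow> (\<Phi> has_real_derivative \<phi> x) (at x)"
    and "continuous_on {s..t} \<Phi>" and "\<And>x. s < x \<Longrightarrow> x < t \<Longrightarrow> \<phi> x \<le> F1 w U W x"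
    and v: "U' t \<le> v" "v < 1"
  shows "l * \<kappa> / 2 * (\<Phi> t - \<Phi> s) \<le> mom v + mom \<beta>"
proof -
  have "l * \<kappa> / 2 * (\<Phi> t - \<Phi> s) \<le> P t - P s" by (rule momentum_gain) (use assms in auto)
  moreover have "- mom \<beta> \<le> P s" using P_mono[of u s] assms mom_g_bounds[of u] by (simp add: P_initial)
  moreover have "P t \<le> mom v"
    using v assms(1,2) by (intro le_mom_of_vel_le) (auto simp: U'_eq[symmetric])
  ultimately show ?thesis by linarith
qed

text \<open>The repulsion helps, and the part of the reference momentum removed by the homotopy is
  \<open>l\<close> times an increment of at most \<open>2 * mom \<beta>\<close>; \<open>vel\<close>
  is 1-Lipschitz.\<close>

lemma U'_ge_reference:
  assumes t: "u \<le> t"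
  shows "g t - 2 * mom \<beta> * l \<le> U' t"
proof -
  have "0 \<le> integral {u..t} (\<lambda>s. \<kappa> / 2 * F1 w U W s)"
    using \<kappa>_pos F1_nonneg
    by (intro integral_nonneg integrable_continuous_real continuous_intros
        continuous_on_subset[OF F1_cont]) auto
  then have "0 \<le> l * integral {u..t} (\<lambda>s. \<kappa> / 2 * F1 w U W s)"
    by (rule mult_nonneg_nonneg[OF l_nonneg])
  then have "mom (g t) - l * (mom (g t) - mom (g u)) \<le> P t"
    unfolding momentum_def by (simp only: left_diff_distrib right_diff_distrib mult_1_left)
  moreover have "l * (mom (g t) - mom (g u)) \<le> l * (2 * mom \<beta>)"
    using l_nonneg mom_g_bounds[OF t] mom_g_bounds[of u] by (intro mult_left_mono) auto
  ultimately have "mom (g t) - 2 * mom \<beta> * l \<le> P t" by (simp add: algebra_simps)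
  then have "vel (mom (g t) - 2 * mom \<beta> * l) \<le> U' t" by (simp add: U'_eq[OF t] vel_mono)
  moreover have "vel (mom (g t)) - vel (mom (g t) - 2 * mom \<beta> * l) \<le> 2 * mom \<beta> * l"
    using vel_diff_le[of "mom (g t) - 2 * mom \<beta> * l" "mom (g t)"] l_nonneg
      mom_nonneg[OF \<beta>_nonneg \<beta>_less_1] by simp
  ultimately show ?thesis using abs_g_less_1[OF t] by (simp add: vel_mom)
qed

text \<open>A one-sided bound on \<open>W'\<close> suffices, and it comes from convexity and the
  initial data; so there is no circle between the bounds of the two particles.\<close>

lemma U'_le:
  assumes c: "0 < c" "\<And>t. u \<le> t \<Longrightarrow> c * (1 + t) \<le> U t - W t"
    and W'_le: "\<And>s. w \<le> s \<Longrightarrow> W' s \<le> \<beta>" and t: "u \<le> t"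
  shows "U' t \<le> vel (5 * mom \<beta> + sqrt (1 + (mom \<beta>)^2) + 16 * \<kappa> / ((1 - \<beta>) * c^2))"
proof -
  \<comment> \<open>For the retarded term: 2 from \<open>1 + U'\<close>,
    \<open>2 / (1 - \<beta>)\<close> from the velocity factor and \<open>4 / c^2\<close> from the
    distance. The advanced term needs only \<open>8 / c^2\<close>.\<close>
  define K where "K = 16 / ((1 - \<beta>) * c^2)"
  have K: "0 \<le> K" "8 / c^2 \<le> K" using \<beta>_less_1 \<beta>_nonneg c(1)
    by (auto simp: K_def frac_le intro!: frac_le mult_left_le_one_le)
  \<comment> \<open>The derivative of \<open>P + sqrt (1 + P\<^sup>2)\<close> is \<open>(1 + U') P'\<close>; the subtracted and added terms compensate
    the reference momentum, the retarded and the advanced force, so \<open>m\<close> is nonincreasing.\<close>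
  define m where "m t = P t + sqrt (1 + (P t)^2) - 2 * (1 - l) * mom (g t)
    + l * \<kappa> / 2 * K * (1 / (1 + t) + 1 / (1 + adv t))" for t
  have inv: "1 / x^2 \<le> 4 / (c^2 * (1 + s)^2)" if "c * (1 + s) / 2 \<le> x" "u \<le> s" for x s
  proof -
    have "0 < c * (1 + s) / 2" using that c u_nonneg by auto
    then have "1 / x^2 \<le> 1 / (c * (1 + s) / 2)^2"
      using that(1) by (intro divide_left_mono power_mono mult_pos_pos) auto
    then show ?thesis by (simp add: power_divide power_mult_distrib)
  qed
  have adv_pos: "0 < 1 + adv x" "u \<le> adv x" if "u \<le> x" for x
    using less_adv[OF that] that u_nonneg by auto
  have "m t \<le> m u"
  proof -
    have "- m u \<le> - m t"
    proof (rule DERIV_nonneg_imp_increasing_open[OF t])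
      have "continuous_on {u..} (\<lambda>x. - m x)"
        unfolding m_def
        by (intro continuous_intros P_cont continuous_on_mom g_cont adv_cont abs_g_less_1)
          (use adv_pos u_nonneg in \<open>force+\<close>)
      then show "continuous_on {u..t} (\<lambda>x. - m x)" by (rule continuous_on_subset) auto
      fix x assume "u < x" "x < t"
      then have x: "u < x" "u \<le> x" by auto
      define p' where "p' = (1 - l) * mom' x + l * (\<kappa> / 2 * F1 w U W x)"
      define a' where "a' = (1 + U' x) / (1 + W' (adv x))"
      define r a where "r = W' (ret x)" and "a = W' (adv x)"
      have r: "r \<le> \<beta>" "-1 < r" "r < 1" and a: "-1 < a" "a < 1"
        using W'_le abs_W'_less_1 w_le_ret[OF x(2)] w_le_adv[OF x(2)] by (auto simp: r_def a_def)
      have v: "-1 < U' x" "U' x < 1" using abs_U'_less_1[OF x(2)] by auto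
      have Sx: "x \<in> S" using S x by auto
      have gd: "((\<lambda>t. mom (g t)) has_real_derivative mom' x) (at x)"
        using mom_g_deriv[OF Sx] at_within_atLeast[OF x(1)] by simp
      have d: "((\<lambda>x. - m x) has_real_derivative - ((1 + U' x) * p' - 2 * (1 - l) * mom' x
         - l * \<kappa> / 2 * K * (1 / (1 + x)^2 + a' / (1 + adv x)^2))) (at x)"
      proof -
        have energy: "((\<lambda>z. sqrt (1 + (P z)^2)) has_real_derivative vel (P x) * p') (at x)"
          unfolding p'_def
          by (rule DERIV_chain2[OF has_real_derivative_energy P_deriv_interior[OF x(1)]])
        have "(m has_real_derivative p' + vel (P x) * p' - 2 * (1 - l) * mom' x
            + l * \<kappa> / 2 * K * (- (1 * (0 + 1) / (1 + x)^2) + - (1 * (0 + a') / (1 + adv x)^2))) (at x)"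
          unfolding m_def[abs_def]
          by (intro DERIV_add DERIV_diff DERIV_cmult energy gd DERIV_reciprocal DERIV_const DERIV_ident
              P_deriv_interior[OF x(1), folded p'_def] adv_deriv[OF x(1), folded a'_def])
            (use x u_nonneg adv_pos[OF x(2)] in auto)
        from DERIV_minus[OF this] show ?thesis
          by (simp add: U'_eq[OF x(2)] algebra_simps)
      qed
      have 1: "(1 + r) / (1 - r) * (1 / (x - ret x)^2) \<le> 2 / (1 - \<beta>) * (4 / (c^2 * (1 + x)^2))"
        using r \<beta>_less_1 c(2)[OF x(2)] delay_ge_half(1)[OF x(2)] x
        by (intro mult_mono frac_le inv) auto
      have "(1 + U' x) * ((1 + r) / (1 - r) * (1 / (x - ret x)^2))
          \<le> 2 * (2 / (1 - \<beta>) * (4 / (c^2 * (1 + x)^2)))"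
        by (rule mult_mono[OF _ 1]) (use v r in auto)
      also have "\<dots> = K * (1 / (1 + x)^2)" by (simp add: K_def)
      finally have 2: "(1 + U' x) * ((1 + r) / (1 - r) * (1 / (x - ret x)^2)) \<le> K * (1 / (1 + x)^2)" .
      \<comment> \<open>The factor \<open>1 / (1 + W')\<close> is kept out of this estimate:
        together with \<open>1 + U'\<close> it is \<open>a'\<close>, and the resulting bound is the
        derivative of \<open>- K / (1 + adv x)\<close>.\<close>
      have "(1 - a) * (1 / (adv x - x)^2) \<le> 2 * (4 / (c^2 * (1 + adv x)^2))"
        using a c(2)[OF adv_pos(2)[OF x(2)]] delay_ge_half(3)[OF x(2)] adv_pos(2)[OF x(2)]
        by (intro mult_mono inv) auto
      also have "\<dots> = 8 / c^2 * (1 / (1 + adv x)^2)" by simp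
      also have "\<dots> \<le> K * (1 / (1 + adv x)^2)" by (rule mult_right_mono[OF K(2)]) simp
      finally have "a' * ((1 - a) * (1 / (adv x - x)^2)) \<le> a' * (K * (1 / (1 + adv x)^2))"
        using v a by (intro mult_left_mono) (auto simp: a'_def a_def[symmetric])
      then have 3: "(1 + U' x) * ((1 - a) / (1 + a) * (1 / (adv x - x)^2)) \<le> K * (a' / (1 + adv x)^2)"
        by (simp add: a'_def a_def[symmetric] mult.commute)
      have "(1 + U' x) * F1 w U W x \<le> K * (1 / (1 + x)^2 + a' / (1 + adv x)^2)"
        using 2 3 by (simp add: F1_eq[OF x(2)] r_def[symmetric] a_def[symmetric] distrib_left)
      then have "l * \<kappa> / 2 * ((1 + U' x) * F1 w U W x) \<le> l * \<kappa> / 2 * (K * (1 / (1 + x)^2 + a' / (1 + adv x)^2))"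
        using l_nonneg \<kappa>_pos by (intro mult_left_mono) auto
      moreover have "(1 + U' x) * ((1 - l) * mom' x) \<le> 2 * ((1 - l) * mom' x)"
        using v l_le_1 mom'_nonneg[OF Sx] by (intro mult_right_mono) auto
      moreover have "(1 + U' x) * p' = (1 + U' x) * ((1 - l) * mom' x) + l * \<kappa> / 2 * ((1 + U' x) * F1 w U W x)"
        by (simp add: p'_def algebra_simps)
      ultimately have "0 \<le> - ((1 + U' x) * p' - 2 * (1 - l) * mom' x
         - l * \<kappa> / 2 * K * (1 / (1 + x)^2 + a' / (1 + adv x)^2))"
        by (simp only: mult.assoc)
      with d show "\<exists>y. ((\<lambda>x. - m x) has_real_derivative y) (at x) \<and> 0 \<le> y" by blast
    qed
    then show ?thesis by simp
  qed
  \<comment> \<open>\<open>P t\<close> is now read off from \<open>m t <= m u\<close>. The 5 in the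
    claim is 1 from \<open>P u\<close> plus 4 from the increment of the reference momentum.\<close>
  have "0 \<le> l * \<kappa> / 2 * K * (1 / (1 + t) + 1 / (1 + adv t))"
    using l_nonneg \<kappa>_pos K t u_nonneg adv_pos[OF t] by (intro mult_nonneg_nonneg add_nonneg_nonneg) auto
  then have 1: "P t \<le> m t + 2 * (1 - l) * mom (g t)"
    by (simp add: m_def add_nonneg_nonneg)
  have "2 * (1 - l) * mom (g t) - 2 * (1 - l) * mom (g u) = 2 * (1 - l) * (mom (g t) - mom (g u))"
    by (simp add: algebra_simps)
  also have "\<dots> \<le> 2 * 1 * (2 * mom \<beta>)"
    using mom_g_mono[of u t] mom_g_bounds[OF t] mom_g_bounds[of u] l_nonneg l_le_1 t
    by (intro mult_mono) auto
  finally have 2: "2 * (1 - l) * mom (g t) - 2 * (1 - l) * mom (g u) \<le> 4 * mom \<beta>" by simp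
  have "(mom (g u))^2 \<le> (mom \<beta>)^2"
    using mom_g_bounds[of u] by (intro power2_le_iff_abs_le[THEN iffD2]) auto
  then have 3: "sqrt (1 + (P u)^2) \<le> sqrt (1 + (mom \<beta>)^2)" by (simp add: P_initial)
  have "l * \<kappa> / 2 * K * (1 / (1 + u) + 1 / (1 + adv u)) \<le> 1 * \<kappa> / 2 * K * (1 + 1)"
    using l_nonneg l_le_1 \<kappa>_pos K u_nonneg adv_pos[of u]
    by (intro mult_mono add_mono divide_right_mono mult_nonneg_nonneg add_nonneg_nonneg) (auto simp: divide_le_eq_1)
  then have 4: "l * \<kappa> / 2 * K * (1 / (1 + u) + 1 / (1 + adv u)) \<le> \<kappa> * K" by simp
  have "P t \<le> 5 * mom \<beta> + sqrt (1 + (mom \<beta>)^2) + \<kappa> * K"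
    using 1 2 3 4 \<open>m t \<le> m u\<close> mom_g_bounds[of u] unfolding m_def[of u] P_initial by linarith
  then show ?thesis by (simp add: U'_eq[OF t] vel_mono K_def mult.commute)
qed

text \<open>\<open>vel\<close> has slope in \<open>[0,1]\<close>, so the acceleration lies between 0
  and the derivative of \<open>P\<close>, a convex combination of the two summands.\<close>

lemma U'_deriv:
  assumes "t \<in> S"
  obtains E where "(U' has_real_derivative E) (at t within {u..})"
    "\<bar>E\<bar> \<le> mom' t + \<kappa> / 2 * F1 w U W t"
proof -
  have t: "u \<le> t" using assms S by auto
  define p' where "p' = (1 - l) * mom' t + l * (\<kappa> / 2 * F1 w U W t)"
  define v' where "v' = 1 / ((1 + (P t)^2) * sqrt (1 + (P t)^2))"
  have v': "0 \<le> v'" "v' \<le> 1"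
    using mult_mono[of 1 "1 + (P t)^2" 1 "sqrt (1 + (P t)^2)"] by (auto simp: v'_def)
  have F: "0 \<le> \<kappa> / 2 * F1 w U W t" using F1_nonneg[OF t] \<kappa>_pos by simp
  have m: "0 \<le> mom' t" by (rule mom'_nonneg[OF assms])
  have "0 \<le> (1 - l) * mom' t" "(1 - l) * mom' t \<le> mom' t"
    using m l_nonneg l_le_1 by (simp_all add: mult_left_le_one_le)
  moreover have "0 \<le> l * (\<kappa> / 2 * F1 w U W t)" "l * (\<kappa> / 2 * F1 w U W t) \<le> \<kappa> / 2 * F1 w U W t"
    using mult_nonneg_nonneg[OF l_nonneg F] mult_left_le_one_le[OF F l_nonneg l_le_1] .
  ultimately have p': "0 \<le> p'" "p' \<le> mom' t + \<kappa> / 2 * F1 w U W t"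
    unfolding p'_def by linarith+
  have "((\<lambda>t. vel (P t)) has_real_derivative v' * p') (at t within {u..})"
    unfolding v'_def p'_def by (rule DERIV_chain2[OF has_real_derivative_vel P_deriv[OF assms]])
  then have "(U' has_real_derivative v' * p') (at t within {u..})"
    by (rule has_field_derivative_transform_within[where d = 1]) (use t U'_eq in auto)
  moreover have "v' * p' \<le> 1 * p'" using v' p' by (intro mult_right_mono) auto
  then have "\<bar>v' * p'\<bar> \<le> mom' t + \<kappa> / 2 * F1 w U W t" using v' p' by simp
  ultimately show thesis by (rule that)
qed

text \<open>The reference part vanishes from \<open>T\<close> on, and before that
  \<open>G <= G (1 + T) / (1 + t)\<close>. The force decays like \<open>(1 + t)^(-2)\<close>, which
  is at most \<open>1 / (1 + t)\<close>.\<close>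

lemma acceleration_bound:
  assumes c: "0 < c" "\<And>t. u \<le> t \<Longrightarrow> c * (1 + t) \<le> U t - W t"
    and V: "\<And>s. w \<le> s \<Longrightarrow> \<bar>W' s\<bar> \<le> V" "V < 1"
    and G: "\<And>t. t \<in> S \<Longrightarrow> g' t \<le> G" "\<And>t. T \<le> t \<Longrightarrow> t \<in> S \<Longrightarrow> g' t = 0" "0 \<le> G" "0 \<le> T"
    and t: "t \<in> S"
  obtains E where "(U' has_real_derivative E) (at t within {u..})"
    "\<bar>E\<bar> \<le> (G * (1 + T) / ((1 - \<beta>^2) * sqrt (1 - \<beta>^2)) + 8 * \<kappa> / ((1 - V) * c^2)) / (1 + t)"
proof -
  have ut: "u \<le> t" "0 \<le> t" using t S u_nonneg by auto
  have \<beta>2: "0 < 1 - \<beta>^2" using \<beta>_nonneg \<beta>_less_1 by (intro one_minus_sq_pos) auto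
  have "(g t)^2 \<le> \<beta>^2" using abs_g_le[OF ut(1)] by (simp add: abs_le_square_iff[symmetric])
  then have "1 / ((1 - (g t)^2) * sqrt (1 - (g t)^2)) \<le> 1 / ((1 - \<beta>^2) * sqrt (1 - \<beta>^2))"
    using \<beta>2 by (intro divide_left_mono mult_mono) auto
  moreover have "g' t \<le> G * (1 + T) / (1 + t)"
  proof (cases "T \<le> t")
    case False
    then have "G * (1 + t) \<le> G * (1 + T)" using G by (intro mult_left_mono) auto
    then show ?thesis using G(1)[OF t] ut by (simp add: pos_le_divide_eq) (smt (verit) mult_right_mono)
  qed (use G ut t in auto)
  ultimately have "mom' t \<le> 1 / ((1 - \<beta>^2) * sqrt (1 - \<beta>^2)) * (G * (1 + T) / (1 + t))"
    unfolding mom'_def using \<beta>2 g'_nonneg[OF t] by (intro mult_mono) auto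
  then have 1: "mom' t \<le> G * (1 + T) / ((1 - \<beta>^2) * sqrt (1 - \<beta>^2)) / (1 + t)"
    by (simp add: mult.commute)
  have "1 + t \<le> (1 + t)^2" using ut by (simp add: power2_eq_square)
  then have "c^2 * (1 + t) \<le> (c * (1 + t))^2"
    by (simp only: power_mult_distrib mult_left_mono zero_le_power2)
  also have "\<dots> \<le> (U t - W t)^2" using c ut by (intro power_mono) auto
  finally have "16 / ((1 - V) * (U t - W t)^2) \<le> 16 / ((1 - V) * (c^2 * (1 + t)))"
    using V c ut W_less_U[of t] by (intro divide_left_mono mult_mono mult_pos_pos) auto
  then have "F1 w U W t \<le> 16 / ((1 - V) * c^2) / (1 + t)"
    using F1_upper[OF ut(1) V] by (simp add: mult.assoc)
  then have "\<kappa> / 2 * F1 w U W t \<le> \<kappa> / 2 * (16 / ((1 - V) * c^2) / (1 + t))"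
    using \<kappa>_pos by (intro mult_left_mono) auto
  then have 2: "\<kappa> / 2 * F1 w U W t \<le> 8 * \<kappa> / ((1 - V) * c^2) / (1 + t)" by (simp add: mult_ac)
  obtain E where "(U' has_real_derivative E) (at t within {u..})"
    "\<bar>E\<bar> \<le> mom' t + \<kappa> / 2 * F1 w U W t" using U'_deriv[OF t] .
  then show thesis using 1 2 by (intro that[of E]) (auto simp: add_divide_distrib)
qed

end

section \<open>Distance and relative velocity of the pair\<close>

text \<open>The coefficient in \<open>F1_lower\<close> for \<open>b = \<beta>\<close> and
  \<open>v = (1 + \<beta>) / 2\<close>. This \<open>v\<close> exceeds \<open>\<beta>\<close> by the
  slack \<open>(1 - \<beta>) / 2\<close> that a small relative velocity may use up.\<close>

definition repulsion :: "real \<Rightarrow> real" where "repulsion \<beta> = (1 - \<beta>) / 4 * (1 - \<beta>)^2"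

text \<open>Both particles are instances of \<open>driven\<close>, the second one reflected, so
  one-particle estimates apply to either. \<open>I\<^sub>0\<close> and
  \<open>\<delta>\<^sub>0\<close> are the margins of the reference pair in distance and relative
  velocity.\<close>

locale two_body =
  X: driven 0 Tm q X Y X' Y' \<kappa>a l \<beta> x0' x0'' "{0..}" +
  Y: driven Tp 0 q "\<lambda>t. - Y t" "\<lambda>t. - X t" "\<lambda>t. - Y' t" "\<lambda>t. - X' t" \<kappa>b l \<beta>
    "\<lambda>t. - y0' t" "\<lambda>t. - y0'' t" "{Tp<..}"
  for Tm Tp q l \<beta> \<kappa>a \<kappa>b :: real and X Y X' Y' x0' x0'' y0' y0'' :: "real \<Rightarrow> real" +
  fixes x0 y0 :: "real \<Rightarrow> real" and I\<^sub>0 \<delta>\<^sub>0 :: real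
  assumes x0_deriv: "t \<ge> 0 \<Longrightarrow> (x0 has_real_derivative x0' t) (at t within {0..})"
    and y0_deriv: "t \<ge> Tp \<Longrightarrow> (y0 has_real_derivative y0' t) (at t within {Tp..})"
    and X_initial: "X 0 = x0 0"
    and Y_initial: "Tm \<le> t \<Longrightarrow> t \<le> Tp \<Longrightarrow> Y t = y0 t"
    and abs_Y'_initial: "Tm \<le> t \<Longrightarrow> t \<le> Tp \<Longrightarrow> \<bar>Y' t\<bar> \<le> \<beta>"
    and I\<^sub>0: "0 < I\<^sub>0" "t \<ge> 0 \<Longrightarrow> I\<^sub>0 \<le> x0 t - y0 t"
    and \<delta>\<^sub>0: "0 < \<delta>\<^sub>0" "\<delta>\<^sub>0 \<le> x0' (Tp + 1) - y0' (Tp + 1)"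
begin

section \<open>Monotonicity of the relative motion\<close>

lemma Tp_nonneg: "0 \<le> Tp" by (rule Y.w_le_u)
lemma Tm_nonpos: "Tm \<le> 0" by (rule X.w_le_u)

lemma Y'_le: "Tm \<le> t \<Longrightarrow> Y' t \<le> \<beta>"
  using Y.U'_ge[of t] abs_Y'_initial[of t] by (cases "t \<le> Tp") auto

lemma X'_ge: "0 \<le> t \<Longrightarrow> - \<beta> \<le> X' t"
  by (rule X.U'_ge)

lemma Y'_antimono: "Tp \<le> s \<Longrightarrow> s \<le> t \<Longrightarrow> Y' t \<le> Y' s"
  using Y.U'_mono[of s t] by simp

lemma distance_deriv:
  "0 \<le> t \<Longrightarrow> ((\<lambda>t. X t - Y t) has_real_derivative X' t - Y' t) (at t within {0..})"
  using X.U_deriv[of t] X.W_deriv[of t] Tm_nonpos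
  by (intro DERIV_diff) (auto intro: DERIV_subset)

lemma distance_lipschitz:
  assumes "0 \<le> s" "s \<le> t"
  shows "\<bar>(X t - Y t) - (X s - Y s)\<bar> \<le> 2 * (t - s)"
proof -
  have "- 2 \<le> X' r - Y' r \<and> X' r - Y' r \<le> 2" if "s < r" for r
    using X.abs_U'_less_1[of r] X.abs_W'_less_1[of r] that assms Tm_nonpos by auto
  then show ?thesis
    using lower_difference[OF distance_deriv assms, of "-2"]
      upper_difference[OF distance_deriv assms, of 2] by auto
qed

lemma relative_velocity_mono: "Tp \<le> s \<Longrightarrow> s \<le> t \<Longrightarrow> X' s - Y' s \<le> X' t - Y' t"
  using X.U'_mono[of s t] Y'_antimono[of s t] Tp_nonneg by auto

lemma mom_\<beta>_nonneg: "0 \<le> mom \<beta>"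
  using X.\<beta>_nonneg X.\<beta>_less_1 by (rule mom_nonneg)

section \<open>Small homotopy parameter\<close>

text \<open>Each velocity is worse than its reference by at most \<open>2 * mom \<beta> * l\<close>.
  Integrated in time this loss would grow without bound, so it is integrated only up to
  \<open>Tp + 1\<close>.\<close>

lemma
  assumes small: "4 * mom \<beta> * l \<le> \<delta>\<^sub>0 / 2" "4 * mom \<beta> * l * (Tp + 1) \<le> I\<^sub>0 / 2"
  shows relative_velocity_weak: "Tp + 1 \<le> t \<Longrightarrow> \<delta>\<^sub>0 / 2 \<le> X' t - Y' t"
    and distance_weak: "0 \<le> t \<Longrightarrow> I\<^sub>0 / 2 \<le> X t - Y t"
proof -
  show vel: "\<delta>\<^sub>0 / 2 \<le> X' t - Y' t" if t: "Tp + 1 \<le> t" for t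
  proof -
    have "x0' (Tp + 1) \<le> x0' t" "y0' t \<le> y0' (Tp + 1)"
      using X.g_mono[of "Tp + 1" t] Y.g_mono[of "Tp + 1" t] t Tp_nonneg by auto
    moreover have "x0' t - 2 * mom \<beta> * l \<le> X' t" "Y' t \<le> y0' t + 2 * mom \<beta> * l"
      using X.U'_ge_reference[of t] Y.U'_ge_reference[of t] t Tp_nonneg by auto
    ultimately show ?thesis using \<delta>\<^sub>0 small(1) by linarith
  qed
  let ?C = "2 * mom \<beta> * l"
  have C: "0 \<le> ?C" using mom_\<beta>_nonneg X.l_nonneg by simp
  have near: "I\<^sub>0 / 2 \<le> X t - Y t" if t: "0 \<le> t" "t \<le> Tp + 1" for t
  proof -
    have "- ?C * (t - 0) \<le> (X t - x0 t) - (X 0 - x0 0)"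
      by (rule lower_difference[of 0 "\<lambda>t. X t - x0 t" "\<lambda>t. X' t - x0' t"])
        (use t X.U'_ge_reference in \<open>auto intro!: DERIV_diff X.U_deriv x0_deriv simp: algebra_simps\<close>)
    then have 1: "x0 t - ?C * t \<le> X t" using X_initial by simp
    have 2: "Y t \<le> y0 t + ?C * t"
    proof (cases "t \<le> Tp")
      case True
      then show ?thesis using Y_initial[of t] t Tm_nonpos C by simp
    next
      case False
      have "- ?C * (t - Tp) \<le> (- Y t - - y0 t) - (- Y Tp - - y0 Tp)"
        by (rule lower_difference[OF DERIV_diff[OF Y.U_deriv DERIV_minus[OF y0_deriv]]])
          (use False Y.U'_ge_reference in \<open>auto simp: algebra_simps\<close>)
      moreover have "?C * (t - Tp) \<le> ?C * t" using C Tp_nonneg by (intro mult_left_mono) auto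
      moreover have "Y Tp = y0 Tp" using Y_initial[of Tp] Tm_nonpos Tp_nonneg by simp
      ultimately show ?thesis by simp
    qed
    have "?C * t \<le> ?C * (Tp + 1)" using C t by (intro mult_left_mono) auto
    then show ?thesis using 1 2 I\<^sub>0(2)[OF t(1)] small(2) by linarith
  qed
  show "I\<^sub>0 / 2 \<le> X t - Y t" if t: "0 \<le> t"
  proof (cases "t \<le> Tp + 1")
    case False
    \<comment> \<open>After \<open>Tp + 1\<close> the relative velocity is positive and the distance
      no longer decreases.\<close>
    have pos: "0 \<le> X' s - Y' s" if "Tp + 1 < s" for s
      using vel[of s] that \<delta>\<^sub>0(1) by linarith
    have "0 * (t - (Tp + 1)) \<le> (X t - Y t) - (X (Tp + 1) - Y (Tp + 1))"
      by (rule lower_difference[OF distance_deriv]) (use False Tp_nonneg pos in auto)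
    then show ?thesis using near[of "Tp + 1"] Tp_nonneg by simp
  qed (use near t in auto)
qed

lemma repulsion_pos: "0 < repulsion \<beta>"
  using X.\<beta>_less_1 by (simp add: repulsion_def)

lemma F1_ge:
  assumes t: "0 \<le> t" and Y': "\<And>s. Tm \<le> s \<Longrightarrow> s \<le> t \<Longrightarrow> - ((1 + \<beta>) / 2) \<le> Y' s"
  shows "repulsion \<beta> / (X t - Y t)^2 \<le> F1 Tm X Y t"
proof -
  have "(1 - ((1 + \<beta>) / 2)) / 2 * (1 - \<beta>)^2 / (X t - Y t)^2 \<le> F1 Tm X Y t"
    by (rule X.F1_lower) (use assms Y'_le X.\<beta>_less_1 in auto)
  moreover have "(1 - ((1 + \<beta>) / 2)) / 2 = (1 - \<beta>) / 4" by (simp add: field_simps)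
  ultimately show ?thesis by (simp add: repulsion_def)
qed

section \<open>Homotopy parameter bounded away from 0\<close>

text \<open>At the closest approach \<open>\<tau> > 0\<close> one has \<open>X' <= Y'\<close>, hence
  \<open>X' <= \<beta>\<close> there and \<open>Y' >= -\<beta>\<close> up to then. So the force is
  at least \<open>repulsion \<beta>\<close> over the squared distance, and the momentum it transfers
  before \<open>\<tau>\<close> is of order \<open>1 / d \<tau>\<close>, while at most
  \<open>2 * mom \<beta>\<close> is possible.\<close>

lemma distance_strong:
  assumes l0: "0 < l0" "l0 \<le> l" and t: "0 \<le> t"
  shows "1 / (1 / (X 0 - Y 0) + 8 * mom \<beta> / (l0 * \<kappa>a * repulsion \<beta>)) \<le> X t - Y t"
proof -
  define d where "d t = X t - Y t" for t
  have d_pos: "0 < d t" if "0 \<le> t" for t using X.W_less_U[OF that] by (simp add: d_def)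
  have "continuous_on {0..t} d"
    unfolding d_def by (rule continuous_on_subset[OF DERIV_continuous_on[OF distance_deriv]]) auto
  then obtain \<tau> where \<tau>: "0 \<le> \<tau>" "\<tau> \<le> t" and min: "\<And>s. 0 \<le> s \<Longrightarrow> s \<le> t \<Longrightarrow> d \<tau> \<le> d s"
    using continuous_attains_inf[of "{0..t}" d] t by auto
  let ?K = "8 * mom \<beta> / (l0 * \<kappa>a * repulsion \<beta>)"
  have pos: "0 < l0 * \<kappa>a * repulsion \<beta>" using l0 X.\<kappa>_pos repulsion_pos by simp
  then have K: "0 \<le> ?K" using mom_\<beta>_nonneg by simp
  have "1 / d \<tau> \<le> 1 / d 0 + ?K"
  proof (cases "\<tau> = 0")
    case False
    then have \<tau>0: "0 < \<tau>" using \<tau> by simp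
    \<comment> \<open>The minimum may lie at the right end \<open>t\<close>, so only earlier times
      are compared, which gives an inequality.\<close>
    have closest: "X' \<tau> - Y' \<tau> \<le> 0"
    proof (rule ccontr)
      assume "\<not> ?thesis"
      moreover have "(d has_real_derivative X' \<tau> - Y' \<tau>) (at \<tau>)"
        using distance_deriv[of \<tau>] \<tau>0 by (simp add: d_def[abs_def] at_within_atLeast)
      ultimately obtain e where e: "0 < e" "\<And>h. 0 < h \<Longrightarrow> h < e \<Longrightarrow> d (\<tau> - h) < d \<tau>"
        using DERIV_pos_inc_left[of d "X' \<tau> - Y' \<tau>" \<tau>] by force
      define h where "h = min (e / 2) \<tau>"
      have "0 < h" "h < e" "h \<le> \<tau>" using e(1) \<tau>0 by (auto simp: h_def)
      with e(2)[of h] min[of "\<tau> - h"] \<tau> show False by auto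
    qed
    have Y'_ge: "- ((1 + \<beta>) / 2) \<le> Y' s" if "Tm \<le> s" "s \<le> \<tau>" for s
    proof -
      have "- \<beta> \<le> Y' s"
        using abs_Y'_initial[of s] Y'_antimono[of s \<tau>] X'_ge[of \<tau>] closest \<tau> that
        by (cases "s \<le> Tp") auto
      then show ?thesis using X.\<beta>_less_1 by (simp add: field_simps)
    qed
    \<comment> \<open>The relative speed is at most 2, so
      \<open>d s <= d \<tau> + 2 * (\<tau> - s)\<close>; \<open>\<Phi>\<close> integrates the
      inverse square of the right side.\<close>
    define \<Phi> where "\<Phi> s = repulsion \<beta> / 2 / (d \<tau> + 2 * (\<tau> - s))" for s
    have den: "0 < d s" "d s \<le> d \<tau> + 2 * (\<tau> - s)" if "0 \<le> s" "s \<le> \<tau>" for s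
      using d_pos[OF that(1)] distance_lipschitz[OF that] by (auto simp: d_def)
    have "l * \<kappa>a / 2 * (\<Phi> \<tau> - \<Phi> 0) \<le> mom \<beta> + mom \<beta>"
    proof (rule X.momentum_gain_le[where \<Phi> = \<Phi>])
      show "(\<Phi> has_real_derivative repulsion \<beta> / (d \<tau> + 2 * (\<tau> - s))^2) (at s)" if "0 < s" "s < \<tau>" for s
      proof -
        have "((\<lambda>s. d \<tau> + 2 * (\<tau> - s)) has_real_derivative - 2) (at s)"
          by (auto intro!: derivative_eq_intros)
        from DERIV_reciprocal[OF this, of "repulsion \<beta> / 2"] den[of s] that show ?thesis
          by (simp add: \<Phi>_def[abs_def])
      qed
      show "continuous_on {0..\<tau>} \<Phi>"
        unfolding \<Phi>_def[abs_def] using den by (intro continuous_intros) force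
      show "repulsion \<beta> / (d \<tau> + 2 * (\<tau> - s))^2 \<le> F1 Tm X Y s" if "0 < s" "s < \<tau>" for s
      proof -
        have "repulsion \<beta> / (d \<tau> + 2 * (\<tau> - s))^2 \<le> repulsion \<beta> / (d s)^2"
          using den[of s] that repulsion_pos by (intro divide_left_mono power_mono mult_pos_pos) auto
        also have "\<dots> \<le> F1 Tm X Y s"
          unfolding d_def using that Y'_ge by (intro F1_ge) auto
        finally show ?thesis .
      qed
      show "X' \<tau> \<le> \<beta>" using closest Y'_le[of \<tau>] \<tau> Tm_nonpos by linarith
    qed (use \<tau> X.\<beta>_less_1 in auto)
    moreover have "\<Phi> 0 \<le> repulsion \<beta> / 2 / d 0"
      unfolding \<Phi>_def using den[of 0] \<tau> repulsion_pos by (intro divide_left_mono mult_pos_pos) auto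
    moreover have "\<Phi> \<tau> = repulsion \<beta> / 2 / d \<tau>" by (simp add: \<Phi>_def)
    ultimately have gain: "l * \<kappa>a / 2 * (\<Phi> \<tau> - \<Phi> 0) \<le> 2 * mom \<beta>"
      and \<Phi>: "repulsion \<beta> / 2 * (1 / d \<tau> - 1 / d 0) \<le> \<Phi> \<tau> - \<Phi> 0"
      by (auto simp: right_diff_distrib)
    \<comment> \<open>The sign of \<open>1 / d \<tau> - 1 / d 0\<close> is what allows
      \<open>l\<close> to be replaced by the smaller \<open>l0\<close>.\<close>
    have "d \<tau> \<le> d 0" using min t by simp
    then have "0 \<le> 1 / d \<tau> - 1 / d 0" using d_pos[OF \<tau>(1)] by (simp add: frac_le)
    then have "l0 * \<kappa>a / 2 * (repulsion \<beta> / 2 * (1 / d \<tau> - 1 / d 0)) \<le> l * \<kappa>a / 2 * (\<Phi> \<tau> - \<Phi> 0)"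
      using \<Phi> l0 X.\<kappa>_pos repulsion_pos by (intro mult_mono) auto
    then have "l0 * \<kappa>a / 2 * (repulsion \<beta> / 2 * (1 / d \<tau> - 1 / d 0)) \<le> 2 * mom \<beta>"
      using gain by (rule order_trans)
    moreover have "l0 * \<kappa>a * repulsion \<beta> * z \<le> 8 * m"
      if "l0 * \<kappa>a / 2 * (repulsion \<beta> / 2 * z) \<le> 2 * m" for z m
      using that by (simp add: mult_ac)
    ultimately have "(l0 * \<kappa>a * repulsion \<beta>) * (1 / d \<tau> - 1 / d 0) \<le> 8 * mom \<beta>"
      by blast
    then have "1 / d \<tau> - 1 / d 0 \<le> ?K"
      using pos by (simp add: pos_le_divide_eq mult.commute)
    then show ?thesis by simp
  qed (use K in auto)
  moreover have "0 < 1 / d \<tau>" "0 < 1 / d 0 + ?K"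
    using d_pos[of \<tau>] d_pos[of 0] \<tau> K by (auto intro: add_pos_nonneg)
  ultimately have "1 / (1 / d 0 + ?K) \<le> d \<tau>"
    using divide_left_mono[of "1 / d \<tau>" "1 / d 0 + ?K" 1] by simp
  then show ?thesis using min[of t] t by (simp add: d_def)
qed

text \<open>Otherwise, by monotonicity, the relative velocity is at most \<open>\<epsilon>\<close>
  on all of \<open>[Tp, T]\<close>. Then the particles stay close and below the speed
  \<open>(1 + \<beta>) / 2\<close> in the relevant directions, so a constant force acts for too long
  a time.\<close>

lemma relative_velocity_strong:
  assumes l0: "0 < l0" "l0 \<le> l" and \<epsilon>: "0 < \<epsilon>" "\<epsilon> \<le> (1 - \<beta>) / 2" "\<epsilon> * T \<le> 1" and T: "Tp \<le> T"
    and long: "mom ((1 + \<beta>) / 2) + mom \<beta>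
      < l0 * \<kappa>a / 2 * (repulsion \<beta> / (X 0 - Y 0 + 2 * Tp + 1)^2 * (T - Tp))"
    and t: "T \<le> t"
  shows "\<epsilon> \<le> X' t - Y' t"
proof (rule ccontr)
  assume "\<not> ?thesis"
  then have \<epsilon>T: "X' T - Y' T \<le> \<epsilon>" using relative_velocity_mono[OF T t] by simp
  \<comment> \<open>Largest distance up to \<open>T\<close>: the initial one, at most
    \<open>2 * Tp\<close> gained until \<open>Tp\<close>, and at most
    \<open>\<epsilon> * T <= 1\<close> afterwards.\<close>
  define d1 where "d1 = X 0 - Y 0 + 2 * Tp + 1"
  define k where "k = repulsion \<beta> / d1^2"
  have slow: "X' s - Y' s \<le> \<epsilon>" if "Tp \<le> s" "s \<le> T" for s
    using relative_velocity_mono[OF that] \<epsilon>T by simp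
  have Y'_ge: "- ((1 + \<beta>) / 2) \<le> Y' s" if "Tm \<le> s" "s \<le> T" for s
    using abs_Y'_initial[of s] Y'_antimono[of s T] X'_ge[of T] \<epsilon>T \<epsilon>(2) X.\<beta>_less_1 T Tp_nonneg that
    by (cases "s \<le> Tp") (auto simp: field_simps)
  have close: "X s - Y s \<le> d1" if s: "Tp \<le> s" "s \<le> T" for s
  proof -
    have "(X s - Y s) - (X Tp - Y Tp) \<le> \<epsilon> * (s - Tp)"
      by (rule upper_difference[OF distance_deriv]) (use s slow Tp_nonneg in auto)
    also have "\<dots> \<le> \<epsilon> * T" using \<epsilon>(1) s Tp_nonneg by (intro mult_left_mono) auto
    finally show ?thesis
      using \<epsilon>(3) distance_lipschitz[of 0 Tp] Tp_nonneg by (simp add: d1_def)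
  qed
  have "l * \<kappa>a / 2 * (k * T - k * Tp) \<le> mom ((1 + \<beta>) / 2) + mom \<beta>"
  proof (rule X.momentum_gain_le[where \<phi> = "\<lambda>s. k" and \<Phi> = "\<lambda>s. k * s"])
    show "((\<lambda>s. k * s) has_real_derivative k) (at s)" for s
      by (auto intro!: derivative_eq_intros)
    show "k \<le> F1 Tm X Y s" if "Tp < s" "s < T" for s
    proof -
      have "k \<le> repulsion \<beta> / (X s - Y s)^2"
        unfolding k_def using close[of s] X.W_less_U[of s] repulsion_pos that Tp_nonneg
        by (intro divide_left_mono power_mono mult_pos_pos) auto
      also have "\<dots> \<le> F1 Tm X Y s" using that Y'_ge Tp_nonneg by (intro F1_ge) auto
      finally show ?thesis .
    qed
    show "X' T \<le> (1 + \<beta>) / 2" using \<epsilon>T \<epsilon>(2) Y'_le[of T] T Tp_nonneg Tm_nonpos by (simp add: field_simps)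
  qed (use T Tp_nonneg X.\<beta>_less_1 in \<open>auto intro!: continuous_intros\<close>)
  moreover have "l0 * \<kappa>a / 2 * (k * (T - Tp)) \<le> l * \<kappa>a / 2 * (k * (T - Tp))"
    using l0 X.\<kappa>_pos repulsion_pos T by (intro mult_right_mono) (auto simp: k_def)
  ultimately show False using long by (simp add: k_def d1_def right_diff_distrib)
qed

section \<open>Linear growth of the distance and uniform bounds\<close>

text \<open>Up to \<open>T\<close> the constant bound \<open>D\<close> dominates, since
  \<open>1 + t <= 1 + T\<close>; from then on the distance grows at least at the rate
  \<open>v\<close>.\<close>

lemma linear_growth:
  assumes D: "0 < D" "\<And>t. 0 \<le> t \<Longrightarrow> D \<le> X t - Y t"
    and v: "\<And>t. T \<le> t \<Longrightarrow> v \<le> X' t - Y' t" and T: "0 \<le> T" and t: "0 \<le> t"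
  shows "min (D / (1 + T)) v * (1 + t) \<le> X t - Y t"
proof (cases "t \<le> T")
  case True
  then have "min (D / (1 + T)) v * (1 + t) \<le> D / (1 + T) * (1 + T)"
    using D(1) T t by (intro mult_mono) auto
  then show ?thesis using D(2)[OF t] T by simp
next
  case False
  have "v * (t - T) \<le> (X t - Y t) - (X T - Y T)"
    by (rule lower_difference[OF distance_deriv]) (use False T v in auto)
  moreover have "min (D / (1 + T)) v * (1 + T) \<le> D / (1 + T) * (1 + T)"
    using T by (intro mult_right_mono) auto
  moreover have "min (D / (1 + T)) v * (t - T) \<le> v * (t - T)"
    using False by (intro mult_right_mono) auto
  moreover have "D / (1 + T) * (1 + T) = D" using T by simp
  moreover have "min (D / (1 + T)) v * (1 + t)
      = min (D / (1 + T)) v * (1 + T) + min (D / (1 + T)) v * (t - T)"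
    by (simp add: algebra_simps)
  ultimately show ?thesis using D(2)[OF T] by linarith
qed

text \<open>Linear growth gives the outer bounds on \<open>X'\<close> and \<open>Y'\<close>, the
  inner ones \<open>X' >= -\<beta>\<close> and \<open>Y' <= \<beta>\<close> being known. The
  two-sided bound \<open>V\<close> then controls the forces and with them the accelerations.\<close>

lemma
  assumes D: "0 < D" "\<And>t. 0 \<le> t \<Longrightarrow> D \<le> X t - Y t"
    and v: "0 < v" "\<And>t. T \<le> t \<Longrightarrow> v \<le> X' t - Y' t" and T: "0 \<le> T"
    and c: "c = min (D / (1 + T)) v"
    and V: "\<beta> \<le> V" "V < 1"
      "vel (5 * mom \<beta> + sqrt (1 + (mom \<beta>)^2) + 16 * \<kappa>a / ((1 - \<beta>) * c^2)) \<le> V"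
      "vel (5 * mom \<beta> + sqrt (1 + (mom \<beta>)^2) + 16 * \<kappa>b / ((1 - \<beta>) * c^2)) \<le> V"
  shows abs_X'_le: "0 \<le> t \<Longrightarrow> \<bar>X' t\<bar> \<le> V"
    and abs_Y'_le: "Tm \<le> t \<Longrightarrow> \<bar>Y' t\<bar> \<le> V"
    and X'_deriv: "\<lbrakk>0 \<le> G; 0 \<le> S; \<And>t. 0 \<le> t \<Longrightarrow> \<bar>x0'' t\<bar> \<le> G; \<And>t. S \<le> t \<Longrightarrow> x0'' t = 0; 0 \<le> t\<rbrakk>
      \<Longrightarrow> \<exists>E. (X' has_real_derivative E) (at t within {0..}) \<and>
        \<bar>E\<bar> \<le> (G * (1 + S) / ((1 - \<beta>^2) * sqrt (1 - \<beta>^2)) + 8 * \<kappa>a / ((1 - V) * c^2)) / (1 + t)"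
    and Y'_deriv: "\<lbrakk>0 \<le> G; 0 \<le> S; \<And>t. Tp < t \<Longrightarrow> \<bar>y0'' t\<bar> \<le> G; \<And>t. S \<le> t \<Longrightarrow> y0'' t = 0; Tp < t\<rbrakk>
      \<Longrightarrow> \<exists>E. (Y' has_real_derivative E) (at t) \<and>
        \<bar>E\<bar> \<le> (G * (1 + S) / ((1 - \<beta>^2) * sqrt (1 - \<beta>^2)) + 8 * \<kappa>b / ((1 - V) * c^2)) / (1 + t)"
proof -
  have c_pos: "0 < c" using D v T by (simp add: c)
  have growth: "c * (1 + t) \<le> X t - Y t" if "0 \<le> t" for t
    unfolding c by (rule linear_growth) (use D v T that in auto)
  have growthY: "c * (1 + t) \<le> - Y t - - X t" if "Tp \<le> t" for t
    using growth[of t] that Tp_nonneg by simp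
  show X': "\<bar>X' t\<bar> \<le> V" if "0 \<le> t" for t
    using X.U'_le[OF c_pos growth Y'_le that] X'_ge[OF that] V by linarith
  show Y': "\<bar>Y' t\<bar> \<le> V" if t: "Tm \<le> t" for t
  proof (cases "t \<le> Tp")
    case True
    then show ?thesis using abs_Y'_initial[OF t] V(1) by linarith
  next
    case False
    have "- Y' t \<le> V"
      by (rule order_trans[OF Y.U'_le[OF c_pos growthY] V(4)]) (use X'_ge False in \<open>auto simp: minus_le_iff\<close>)
    then show ?thesis using Y'_le[OF t] V(1) by linarith
  qed
  show "\<exists>E. (X' has_real_derivative E) (at t within {0..}) \<and>
      \<bar>E\<bar> \<le> (G * (1 + S) / ((1 - \<beta>^2) * sqrt (1 - \<beta>^2)) + 8 * \<kappa>a / ((1 - V) * c^2)) / (1 + t)"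
    if G: "0 \<le> G" "0 \<le> S" "\<And>t. 0 \<le> t \<Longrightarrow> \<bar>x0'' t\<bar> \<le> G" "\<And>t. S \<le> t \<Longrightarrow> x0'' t = 0" and t: "0 \<le> t" for t G S
    by (rule X.acceleration_bound[OF c_pos growth Y' V(2), of G S t])
      (use G(1,2,4) abs_le_D1[OF G(3)] t in auto)
  show "\<exists>E. (Y' has_real_derivative E) (at t) \<and>
      \<bar>E\<bar> \<le> (G * (1 + S) / ((1 - \<beta>^2) * sqrt (1 - \<beta>^2)) + 8 * \<kappa>b / ((1 - V) * c^2)) / (1 + t)"
    if G: "0 \<le> G" "0 \<le> S" "\<And>t. Tp < t \<Longrightarrow> \<bar>y0'' t\<bar> \<le> G" "\<And>t. S \<le> t \<Longrightarrow> y0'' t = 0" and t: "Tp < t" for t G S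
  proof (rule Y.acceleration_bound[OF c_pos growthY _ V(2), of G S t])
    show "\<bar>- X' s\<bar> \<le> V" if "0 \<le> s" for s using X'[OF that] by simp
    show "- y0'' s \<le> G" if "s \<in> {Tp<..}" for s using abs_le_D2[OF G(3)] that by simp
    fix E assume E: "((\<lambda>t. - Y' t) has_real_derivative E) (at t within {Tp..})"
      "\<bar>E\<bar> \<le> (G * (1 + S) / ((1 - \<beta>^2) * sqrt (1 - \<beta>^2)) + 8 * \<kappa>b / ((1 - V) * c^2)) / (1 + t)"
    from DERIV_minus[OF E(1)] have "(Y' has_real_derivative - E) (at t)"
      using at_within_atLeast[OF t] by simp
    then show ?thesis using E(2) by (intro exI[of _ "- E"]) simp
  qed (use G t in auto)
qed

end

section \<open>Fixed points of the homotopy\<close>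

lemma at_within_Icc_neq_bot: "a < b \<Longrightarrow> t \<in> {a..b} \<Longrightarrow> at t within {a..b::real} \<noteq> bot"
  by (cases "t = a"; cases "t = b")
    (auto simp: at_within_Icc_at_right at_within_Icc_at_left at_within_Icc_at)

lemma dot_on_deriv:
  assumes "f differentiable_on S" "t \<in> S"
  shows "(f has_real_derivative dot_on S f t) (at t within S)"
  using assms unfolding differentiable_on_def dot_on_def
  by (auto simp: has_real_derivative_iff_has_vector_derivative vector_derivative_works)

text \<open>Used to carry derivatives over to \<open>{Tm..Tp}\<close>, where at the end points they
  are one-sided.\<close>

lemma dot_on_restrict:
  assumes "(f has_real_derivative D) (at t within S)" "T \<subseteq> S" "t \<in> T"
    "\<And>s. s \<in> T \<Longrightarrow> f s = g s" "at t within T \<noteq> bot"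
  shows "dot_on T g t = D"
proof (rule dot_on_eqI)
  show "(g has_real_derivative D) (at t within T)"
    by (rule has_field_derivative_transform_within[OF DERIV_subset[OF assms(1,2)], where d = 1])
      (use assms in auto)
qed fact

lemma sup_norm_less_obtains:
  assumes "sup_norm S f < 1"
  obtains b where "b < 1" "\<And>t. t \<in> S \<Longrightarrow> \<bar>f t\<bar> \<le> b"
proof -
  obtain b where b: "sup_norm S f < ereal b" "ereal b < 1"
    using ereal_dense2[OF assms] by auto
  show thesis
  proof
    show "b < 1" using b(2) by simp
    fix t assume "t \<in> S"
    then have "ereal \<bar>f t\<bar> \<le> sup_norm S f" unfolding sup_norm_def by (rule SUP_upper)
    then have "ereal \<bar>f t\<bar> < ereal b" using b(1) by (rule order.strict_trans1)
    then show "\<bar>f t\<bar> \<le> b" by simp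
  qed
qed

lemma sup_norm_less:
  assumes "\<And>t. t \<in> S \<Longrightarrow> \<bar>f t\<bar> \<le> b" "b < V"
  shows "sup_norm S f < ereal V"
proof -
  have "sup_norm S f \<le> ereal b"
    unfolding sup_norm_def by (rule SUP_least) (use assms(1) in simp)
  also have "ereal b < ereal V" using assms(2) by simp
  finally show ?thesis .
qed

lemma less_INF_ereal:
  assumes "\<And>t. t \<in> S \<Longrightarrow> b \<le> f t" "D < b"
  shows "ereal D < (INF t\<in>S. ereal (f t))"
proof -
  have "ereal D < ereal b" using assms(2) by simp
  also have "\<dots> \<le> (INF t\<in>S. ereal (f t))"
    by (rule INF_greatest) (use assms(1) in simp)
  finally show ?thesis .
qed

locale reference_problem =
  fixes \<kappa>a \<kappa>b Tm Tp a0 va :: real and b0 x0 y0 :: "real \<Rightarrow> real"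
  assumes \<kappa>a_pos: "\<kappa>a > 0" and \<kappa>b_pos: "\<kappa>b > 0"
    and initial: "initial_data Tm Tp a0 va b0"
    and reference: "reference_trajectories Tm Tp a0 va b0 x0 y0"
begin

abbreviation "x0' \<equiv> dot_on {0..} x0"
abbreviation "y0' \<equiv> dot_on {Tm..} y0"
abbreviation "x0'' \<equiv> ddot_on {0..} x0"
abbreviation "y0'' \<equiv> ddot_on {Tp<..} y0"

section \<open>Properties of the data and the reference trajectories\<close>

lemma init: "-1 < va" "va < 1" "Tm < Tp" "b0 differentiable_on {Tm..Tp}"
  "Tm \<le> t \<Longrightarrow> t \<le> Tp \<Longrightarrow> b0 t < a0" "b0 Tp = a0 - Tp" "b0 Tm = a0 + Tm"
  using initial by (auto simp: initial_data_def)

lemma Tp_pos: "0 < Tp" and Tm_neg: "Tm < 0"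
  using init(5)[of Tp] init(5)[of Tm] init(3,6,7) by auto

lemma ref: "x0 differentiable_on {0..}" "x0' differentiable_on {0..}" "continuous_on {0..} x0''"
  "y0 differentiable_on {Tm..}" "continuous_on {Tm..} y0'"
  "dot_on {Tp<..} y0 differentiable_on {Tp<..}"
  "bounded (y0'' ` {Tp<..})" "x0 0 = a0" "x0' 0 = va"
  "Tm \<le> t \<Longrightarrow> t \<le> Tp \<Longrightarrow> y0 t = b0 t"
  "0 < x0' (Tp + 1) - y0' (Tp + 1)" "0 \<le> t \<Longrightarrow> 0 \<le> x0'' t" "Tp < t \<Longrightarrow> y0'' t \<le> 0"
  "Tp + 1 \<le> t \<Longrightarrow> x0'' t = 0" "Tp + 1 \<le> t \<Longrightarrow> y0'' t = 0"
  using reference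
  by (auto simp: reference_trajectories_def ddot_on_def numeral_2_eq_2)

lemma x0_deriv: "0 \<le> t \<Longrightarrow> (x0 has_real_derivative x0' t) (at t within {0..})"
  by (rule dot_on_deriv[OF ref(1)]) simp

lemma y0_deriv: "Tm \<le> t \<Longrightarrow> (y0 has_real_derivative y0' t) (at t within {Tm..})"
  by (rule dot_on_deriv[OF ref(4)]) simp

lemma x0'_deriv: "0 \<le> t \<Longrightarrow> (x0' has_real_derivative x0'' t) (at t within {0..})"
  unfolding ddot_on_def by (rule dot_on_deriv[OF ref(2)]) simp

lemma x0'_cont: "continuous_on {0..} x0'"
  by (rule DERIV_continuous_on[of _ _ x0'']) (use x0'_deriv in auto)

lemma dot_on_Ioi: "Tp < t \<Longrightarrow> dot_on {Tp<..} f t = dot_on {Tm..} f t"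
  using init(3) by (simp add: dot_on_def at_within_greaterThan at_within_atLeast)

lemma y0'_deriv:
  assumes "Tp < t"
  shows "(y0' has_real_derivative y0'' t) (at t)"
proof -
  have "(dot_on {Tp<..} y0 has_real_derivative y0'' t) (at t)"
    using dot_on_deriv[OF ref(6), of t] assms by (simp add: ddot_on_def at_within_greaterThan)
  then show ?thesis
    by (rule has_field_derivative_transform_within_open[of _ _ _ "{Tp<..}"])
      (use assms dot_on_Ioi in auto)
qed

text \<open>\<open>y0\<close> is differentiable at \<open>Tp\<close> and agrees with
  \<open>b0\<close> to the left, so the homotopy starts from one and the same momentum in
  \<open>P2\<close>.\<close>

lemma y0'_initial: "y0' Tp = dot_on {Tm..Tp} b0 Tp"
  by (rule dot_on_restrict[OF y0_deriv, symmetric])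
    (use init(3) ref(10) at_within_Icc_neq_bot in auto)

lemma velocity_bound: obtains \<beta> where "\<beta> < 1" "\<And>t. 0 \<le> t \<Longrightarrow> \<bar>x0' t\<bar> \<le> \<beta>" "\<And>t. Tm \<le> t \<Longrightarrow> \<bar>y0' t\<bar> \<le> \<beta>"
proof -
  obtain b where b: "b < 1" "\<And>t. t \<in> {0..} \<Longrightarrow> \<bar>x0' t\<bar> \<le> b"
    using reference sup_norm_less_obtains[of "{0..}" x0'] by (auto simp: reference_trajectories_def)
  obtain c where c: "c < 1" "\<And>t. t \<in> {Tm..} \<Longrightarrow> \<bar>y0' t\<bar> \<le> c"
    using reference sup_norm_less_obtains[of "{Tm..}" y0'] by (auto simp: reference_trajectories_def)
  show thesis
    by (rule that[of "max b c"]) (use b c in \<open>auto simp: le_max_iff_disj\<close>)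
qed

lemma distance_bound: obtains I\<^sub>0 where "0 < I\<^sub>0" "\<And>t. 0 \<le> t \<Longrightarrow> I\<^sub>0 \<le> x0 t - y0 t"
proof -
  have "0 < (INF t\<in>{0..}. ereal (x0 t - y0 t))"
    using reference by (simp add: reference_trajectories_def)
  from ereal_dense2[OF this] obtain e where e: "0 < ereal e" "ereal e < (INF t\<in>{0..}. ereal (x0 t - y0 t))"
    by auto
  show thesis
  proof
    show "0 < e" using e(1) by simp
    fix t :: real assume "0 \<le> t"
    then have "(INF t\<in>{0..}. ereal (x0 t - y0 t)) \<le> ereal (x0 t - y0 t)" by (intro INF_lower) auto
    with e(2) have "ereal e < ereal (x0 t - y0 t)" by (rule order.strict_trans2)
    then show "e \<le> x0 t - y0 t" by simp
  qed
qed

text \<open>For \<open>x0\<close> by compactness up to \<open>Tp + 1\<close> and vanishing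
  afterwards; for \<open>y0\<close> boundedness is part of the data.\<close>

lemma acceleration_bound: obtains G where "0 \<le> G" "\<And>t. 0 \<le> t \<Longrightarrow> \<bar>x0'' t\<bar> \<le> G" "\<And>t. Tp < t \<Longrightarrow> \<bar>y0'' t\<bar> \<le> G"
proof -
  have "bounded (x0'' ` {0..Tp + 1})"
    by (intro compact_imp_bounded compact_continuous_image continuous_on_subset[OF ref(3)]) auto
  then obtain a where a: "\<forall>t\<in>{0..Tp + 1}. \<bar>x0'' t\<bar> \<le> a"
    unfolding bounded_iff by auto
  obtain b where b: "\<forall>t\<in>{Tp<..}. \<bar>y0'' t\<bar> \<le> b"
    using ref(7) unfolding bounded_iff by auto
  have "0 \<le> a" using a Tp_pos by force
  show thesis
  proof
    show "0 \<le> max a b" using \<open>0 \<le> a\<close> by simp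
    show "\<bar>x0'' t\<bar> \<le> max a b" if "0 \<le> t" for t
      using a that ref(14)[of t] \<open>0 \<le> a\<close>
      by (cases "t \<le> Tp + 1") (auto simp: le_max_iff_disj)
    show "\<bar>y0'' t\<bar> \<le> max a b" if "Tp < t" for t
      using b that by (simp add: le_max_iff_disj)
  qed
qed

text \<open>Translates a fixed point of \<open>H\<close> into the equations of motion of both
  particles. The bound \<open>q < 1\<close> stems from membership in \<open>M\<close> and may depend
  on the solution.\<close>

lemma two_body_fixed_point:
  assumes l: "0 \<le> l" "l \<le> 1" and xy: "(x, y) \<in> M Tm Tp x0 y0"
    and H1: "\<And>t. t \<ge> 0 \<Longrightarrow> H1 \<kappa>a Tm a0 va x0 y0 l x y t = x t"
    and H2: "\<And>t. t \<ge> Tm \<Longrightarrow> H2 \<kappa>b Tm Tp b0 x0 y0 l x y t = y t"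
    and \<beta>: "\<beta> < 1" "\<And>t. 0 \<le> t \<Longrightarrow> \<bar>x0' t\<bar> \<le> \<beta>" "\<And>t. Tm \<le> t \<Longrightarrow> \<bar>y0' t\<bar> \<le> \<beta>"
    and I\<^sub>0: "0 < I\<^sub>0" "\<And>t. 0 \<le> t \<Longrightarrow> I\<^sub>0 \<le> x0 t - y0 t"
  defines "X \<equiv> \<lambda>t. x t + x0 t" and "Y \<equiv> \<lambda>t. y t + y0 t"
  obtains q where "two_body Tm Tp q l \<beta> \<kappa>a \<kappa>b X Y (dot_on {0..} X) (dot_on {Tm..} Y)
    x0' x0'' y0' y0'' x0 y0 I\<^sub>0 (x0' (Tp + 1) - y0' (Tp + 1))"
proof -
  define X' Y' where "X' = dot_on {0..} X" and "Y' = dot_on {Tm..} Y"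
  have M: "x differentiable_on {0..}" "continuous_on {0..} (dot_on {0..} x)"
    "y differentiable_on {Tm..}" "continuous_on {Tm..} (dot_on {Tm..} y)"
    "x 0 = 0" "\<And>t. Tm \<le> t \<Longrightarrow> t \<le> Tp \<Longrightarrow> y t = 0"
    "sup_norm {0..} X' < 1" "sup_norm {Tm..} Y' < 1" "\<And>t. 0 \<le> t \<Longrightarrow> Y t < X t"
    using xy by (auto simp: M_def X'_def Y'_def X_def Y_def)
  have X_sum: "(X has_real_derivative dot_on {0..} x t + x0' t) (at t within {0..})" if "0 \<le> t" for t
    unfolding X_def using that by (intro DERIV_add dot_on_deriv M x0_deriv) auto
  have Y_sum: "(Y has_real_derivative dot_on {Tm..} y t + y0' t) (at t within {Tm..})" if "Tm \<le> t" for t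
    unfolding Y_def using that by (intro DERIV_add dot_on_deriv M y0_deriv) auto
  have X'_sum: "X' t = dot_on {0..} x t + x0' t" if "0 \<le> t" for t
    unfolding X'_def using X_sum[OF that] by (rule dot_on_eqI) (use that at_within_atLeast_neq_bot in simp)
  have Y'_sum: "Y' t = dot_on {Tm..} y t + y0' t" if "Tm \<le> t" for t
    unfolding Y'_def using Y_sum[OF that] by (rule dot_on_eqI) (use that at_within_atLeast_neq_bot in simp)
  have X_deriv: "(X has_real_derivative X' t) (at t within {0..})" if "0 \<le> t" for t
    using X_sum[OF that] X'_sum[OF that] by simp
  have Y_deriv: "(Y has_real_derivative Y' t) (at t within {Tm..})" if "Tm \<le> t" for t
    using Y_sum[OF that] Y'_sum[OF that] by simp
  have X'_cont: "continuous_on {0..} X'"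
    by (rule continuous_on_eq[OF continuous_on_add[OF M(2) x0'_cont]]) (simp add: X'_sum)
  have Y'_cont: "continuous_on {Tm..} Y'"
    by (rule continuous_on_eq[OF continuous_on_add[OF M(4) ref(5)]]) (simp add: Y'_sum)
  obtain qx where qx: "qx < 1" "\<And>t. t \<in> {0..} \<Longrightarrow> \<bar>X' t\<bar> \<le> qx"
    using sup_norm_less_obtains[OF M(7)] by blast
  obtain qy where qy: "qy < 1" "\<And>t. t \<in> {Tm..} \<Longrightarrow> \<bar>Y' t\<bar> \<le> qy"
    using sup_norm_less_obtains[OF M(8)] by blast
  define q where "q = max qx qy"
  have q: "q < 1" "\<And>t. 0 \<le> t \<Longrightarrow> \<bar>X' t\<bar> \<le> q" "\<And>t. Tm \<le> t \<Longrightarrow> \<bar>Y' t\<bar> \<le> q"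
    using qx qy by (auto simp: q_def le_max_iff_disj)
  have X0: "X 0 = a0" using M(5) ref(8) by (simp add: X_def)
  have Y_init: "Y t = b0 t" if "Tm \<le> t" "t \<le> Tp" for t
    using M(6)[OF that] ref(10)[OF that] by (simp add: Y_def)
  interpret dX: delay 0 Tm q X Y X' Y'
    by unfold_locales
      (use Tm_neg q X_deriv Y_deriv Y'_cont M(9) X0 Y_init[of Tm] init(3,7) in auto)
  interpret dY: delay Tp 0 q "\<lambda>t. - Y t" "\<lambda>t. - X t" "\<lambda>t. - Y' t" "\<lambda>t. - X' t"
  proof
    show "((\<lambda>t. - Y t) has_real_derivative - Y' t) (at t within {Tp..})" if "Tp \<le> t" for t
      by (rule DERIV_minus[OF DERIV_subset[OF Y_deriv]]) (use that init(3) in auto)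
    show "((\<lambda>t. - X t) has_real_derivative - X' t) (at t within {0..})" if "0 \<le> t" for t
      by (rule DERIV_minus[OF X_deriv[OF that]])
  qed (use Tp_pos Tm_neg q X'_cont M(9) X0 Y_init[of Tp] init(3,6) in \<open>auto intro: continuous_on_minus\<close>)
  \<comment> \<open>The reflection exchanges \<open>1 + Y'\<close> with \<open>1 - X'\<close> and
    \<open>1 - Y'\<close> with \<open>1 + X'\<close>, and reverses the sign of the force.\<close>
  have F2_eq: "F1 0 (\<lambda>t. - Y t) (\<lambda>t. - X t) t = - F2 X Y t" if t: "Tp \<le> t" for t
  proof -
    have "t2_ret 0 (\<lambda>t. - Y t) (\<lambda>t. - X t) t = t1_ret X Y t"
      "t2_adv 0 (\<lambda>t. - Y t) (\<lambda>t. - X t) t = t1_adv X Y t"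
      by (simp_all add: t2_ret_def t2_adv_def t1_ret_def t1_adv_def)
    then have r: "dY.ret t = t1_ret X Y t" "dY.adv t = t1_adv X Y t"
      by (simp_all add: dY.ret_def dY.adv_def)
    have e: "(Y t - X (dY.ret t))^2 = (t - dY.ret t)^2" "(Y t - X (dY.adv t))^2 = (dY.adv t - t)^2"
      using dY.ret_eq[OF t] dY.adv_eq[OF t] by (simp_all add: power2_commute[of "Y t"])
    show ?thesis
      unfolding dY.F1_eq[OF t] F2_def Let_def r[symmetric] e X'_def[symmetric] by simp
  qed
  have PX: "P1 \<kappa>a Tm va x0 l X Y = momentum \<kappa>a l x0' 0 (F1 Tm X Y)"
    by (rule ext) (simp add: P1_def momentum_def mom_def ref(9))
  have PY: "momentum \<kappa>b l (\<lambda>t. - y0' t) Tp (F1 0 (\<lambda>t. - Y t) (\<lambda>t. - X t)) t = - P2 \<kappa>b Tm Tp b0 y0 l X Y t"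
    for t
  proof -
    have "integral {Tp..t} (\<lambda>s. \<kappa>b / 2 * F1 0 (\<lambda>t. - Y t) (\<lambda>t. - X t) s)
        = integral {Tp..t} (\<lambda>s. - (\<kappa>b / 2 * F2 X Y s))"
      by (rule integral_cong) (simp add: F2_eq)
    also have "\<dots> = - integral {Tp..t} (\<lambda>s. \<kappa>b / 2 * F2 X Y s)" by (rule integral_neg)
    finally have i: "integral {Tp..t} (\<lambda>s. \<kappa>b / 2 * F1 0 (\<lambda>t. - Y t) (\<lambda>t. - X t) s)
        = - integral {Tp..t} (\<lambda>s. \<kappa>b / 2 * F2 X Y s)" .
    show ?thesis
      unfolding P2_def momentum_def i mom_minus y0'_initial[symmetric] mom_def[symmetric] by simp
  qed
  interpret X: driven 0 Tm q X Y X' Y' \<kappa>a l \<beta> x0' x0'' "{0..}"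
  proof
    show "X t = X 0 + integral {0..t} (\<lambda>s. vel (momentum \<kappa>a l x0' 0 (F1 Tm X Y) s))" if "0 \<le> t" for t
    proof -
      have "- x0 t + a0 + integral {0..t} (\<lambda>s. vel (momentum \<kappa>a l x0' 0 (F1 Tm X Y) s)) = x t"
        using H1[OF that] unfolding H1_def Let_def X_def[symmetric] Y_def[symmetric] PX vel_def .
      moreover have "X t = x t + x0 t" by (simp add: X_def)
      ultimately show ?thesis using X0 by linarith
    qed
  qed (use \<kappa>a_pos l \<beta> x0'_cont x0'_deriv ref(12) in auto)
  interpret Y: driven Tp 0 q "\<lambda>t. - Y t" "\<lambda>t. - X t" "\<lambda>t. - Y' t" "\<lambda>t. - X' t" \<kappa>b l \<beta>
    "\<lambda>t. - y0' t" "\<lambda>t. - y0'' t" "{Tp<..}"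
  proof
    show "continuous_on {Tp..} (\<lambda>t. - y0' t)"
      by (intro continuous_on_minus continuous_on_subset[OF ref(5)]) (use init(3) in auto)
    show "((\<lambda>t. - y0' t) has_real_derivative - y0'' t) (at t within {Tp..})" if "t \<in> {Tp<..}" for t
      using that by (intro DERIV_minus has_field_derivative_at_within[OF y0'_deriv]) simp
    show "- Y t = - Y Tp + integral {Tp..t} (\<lambda>s. vel (momentum \<kappa>b l (\<lambda>t. - y0' t) Tp
        (F1 0 (\<lambda>t. - Y t) (\<lambda>t. - X t)) s))" if "Tp \<le> t" for t
    \<comment> \<open>At \<open>Tp\<close> itself the first branch of \<open>H2\<close> applies, and
      the integral equation is trivial.\<close>
    proof (cases "t = Tp")
      case False
      then have "- y0 t + b0 Tp + integral {Tp..t} (\<lambda>s. vel (P2 \<kappa>b Tm Tp b0 y0 l X Y s)) = y t"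
        using H2[of t] that init(3)
        unfolding H2_def Let_def X_def[symmetric] Y_def[symmetric] vel_def by simp
      moreover have "Y t = y t + y0 t" by (simp add: Y_def)
      ultimately have "Y t = b0 Tp + integral {Tp..t} (\<lambda>s. vel (P2 \<kappa>b Tm Tp b0 y0 l X Y s))"
        by linarith
      then show ?thesis using Y_init[of Tp] init(3) by (simp add: PY vel_minus)
    qed simp
  qed (use Tp_pos init(3) \<kappa>b_pos l \<beta> ref(13) in auto)
  have "two_body Tm Tp q l \<beta> \<kappa>a \<kappa>b X Y X' Y' x0' x0'' y0' y0'' x0 y0 I\<^sub>0
      (x0' (Tp + 1) - y0' (Tp + 1))"
  proof
    show "(y0 has_real_derivative y0' t) (at t within {Tp..})" if "Tp \<le> t" for t
      by (rule DERIV_subset[OF y0_deriv]) (use that init(3) in auto)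
    \<comment> \<open>On the initial interval \<open>Y\<close> and \<open>y0\<close> both equal
      \<open>b0\<close>, so their derivatives agree there, end points included.\<close>
    show "\<bar>Y' t\<bar> \<le> \<beta>" if t: "Tm \<le> t" "t \<le> Tp" for t
    proof -
      have nb: "at t within {Tm..Tp} \<noteq> bot" using at_within_Icc_neq_bot init(3) t by simp
      have "dot_on {Tm..Tp} b0 t = Y' t"
        by (rule dot_on_restrict[OF Y_deriv]) (use t Y_init nb in auto)
      moreover have "dot_on {Tm..Tp} b0 t = y0' t"
        by (rule dot_on_restrict[OF y0_deriv]) (use t ref(10) nb in auto)
      ultimately show ?thesis using \<beta>(3)[OF t(1)] by simp
    qed
  qed (use x0_deriv X0 ref(8,10,11) Y_init I\<^sub>0 in auto)
  then show thesis unfolding X'_def Y'_def by (rule that)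
qed

end

section \<open>Choice of the uniform constants\<close>

theorem proposition2p1:
  fixes \<kappa>a \<kappa>b Tm Tp a0 va :: real and b0 x0 y0 :: "real \<Rightarrow> real"
  assumes "\<kappa>a > 0" and "\<kappa>b > 0"
    and "initial_data Tm Tp a0 va b0"
    and "reference_trajectories Tm Tp a0 va b0 x0 y0"
  shows "\<exists>v V A D T :: real.
    v \<in> {0<..<1} \<and> V \<in> {0<..<1} \<and> A > 0 \<and> D > 0 \<and> T > 0 \<and>
    (\<forall>l\<in>{0..1}. \<forall>(x, y)\<in>M Tm Tp x0 y0.
      (\<forall>t\<ge>0. H1 \<kappa>a Tm a0 va x0 y0 l x y t = x t) \<longrightarrow>
      (\<forall>t\<ge>Tm. H2 \<kappa>b Tm Tp b0 x0 y0 l x y t = y t) \<longrightarrow>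
      (let X = (\<lambda>t. x t + x0 t); Y = (\<lambda>t. y t + y0 t) in
        sup_norm {0..} (dot_on {0..} X) < ereal V \<and>
        sup_norm {Tm..} (dot_on {Tm..} Y) < ereal V \<and>
        (INF t\<in>{0..}. ereal (X t - Y t)) > ereal D \<and>
        (INF t\<in>{T..}. ereal (dot_on {0..} X t - dot_on {Tm..} Y t)) > ereal v \<and>
        dot_on {0..} X differentiable_on {0..} \<and>
        dot_on {Tp<..} Y differentiable_on {Tp<..} \<and>
        (\<forall>t\<ge>0. \<bar>ddot_on {0..} X t\<bar> < A / (1 + \<bar>t\<bar>)) \<and>
        (\<forall>t>Tp. \<bar>ddot_on {Tp<..} Y t\<bar> < A / (1 + \<bar>t\<bar>))))"
proof -
  interpret reference_problem \<kappa>a \<kappa>b Tm Tp a0 va b0 x0 y0 by unfold_locales fact+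
  obtain \<beta> where \<beta>: "\<beta> < 1" "\<And>t. 0 \<le> t \<Longrightarrow> \<bar>x0' t\<bar> \<le> \<beta>" "\<And>t. Tm \<le> t \<Longrightarrow> \<bar>y0' t\<bar> \<le> \<beta>"
    by (rule velocity_bound, rule that) auto
  obtain I\<^sub>0 where I\<^sub>0: "0 < I\<^sub>0" "\<And>t. 0 \<le> t \<Longrightarrow> I\<^sub>0 \<le> x0 t - y0 t"
    by (rule distance_bound, rule that) auto
  obtain G where G: "0 \<le> G" "\<And>t. 0 \<le> t \<Longrightarrow> \<bar>x0'' t\<bar> \<le> G" "\<And>t. Tp < t \<Longrightarrow> \<bar>y0'' t\<bar> \<le> G"
    by (rule acceleration_bound, rule that) auto
  have \<beta>0: "0 \<le> \<beta>" using \<beta>(2)[of 0] by simp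
  define m where "m = mom \<beta>"
  define \<delta> where "\<delta> = x0' (Tp + 1) - y0' (Tp + 1)"
  define d0 where "d0 = x0 0 - y0 0"
  have m: "0 \<le> m" unfolding m_def by (rule mom_nonneg[OF \<beta>0 \<beta>(1)])
  have \<delta>: "0 < \<delta>" using ref(11) by (simp add: \<delta>_def)
  have d0: "0 < d0" using I\<^sub>0(1) I\<^sub>0(2)[of 0] by (simp add: d0_def)
  \<comment> \<open>Threshold between the two regimes: for \<open>l <= l0\<close> the loss
    \<open>4 * m * l\<close> is at most half the reference margin, in velocity and, over the time
    \<open>Tp + 1\<close>, in distance. The summand 1 covers \<open>m = 0\<close>.\<close>
  define l0 where "l0 = min (\<delta> / 2) (I\<^sub>0 / 2 / (Tp + 1)) / (4 * m + 1)"
  have l0: "0 < l0" using \<delta> I\<^sub>0 Tp_pos m by (simp add: l0_def)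
  have R: "0 < repulsion \<beta>" using \<beta>(1) by (simp add: repulsion_def)
  define D where "D = min (I\<^sub>0 / 2) (1 / (1 / d0 + 8 * m / (l0 * \<kappa>a * repulsion \<beta>)))"
  have D: "0 < D"
    using I\<^sub>0(1) d0 m l0 R \<kappa>a_pos by (auto simp: D_def intro!: add_pos_nonneg divide_nonneg_nonneg)
  define K where "K = l0 * \<kappa>a / 2 * (repulsion \<beta> / (d0 + 2 * Tp + 1)^2)"
  have K: "0 < K" using l0 \<kappa>a_pos R d0 Tp_pos by (simp add: K_def)
  define m1 where "m1 = mom ((1 + \<beta>) / 2)"
  have m1: "0 \<le> m1" unfolding m1_def by (rule mom_nonneg) (use \<beta>0 \<beta>(1) in auto)
  \<comment> \<open>Late enough for the force bound \<open>K\<close> to exceed the available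
    momentum \<open>m1 + m\<close>, and not before \<open>Tp + 1\<close>, as small \<open>l\<close>
    requires.\<close>
  define T where "T = Tp + 1 + (m1 + m + 1) / K"
  have T: "Tp + 1 \<le> T" using K m m1 by (simp add: T_def)
  have "K * (T - Tp) = K + (m1 + m + 1)" using K by (simp add: T_def field_simps)
  then have long: "m1 + m < K * (T - Tp)" using K by simp
  \<comment> \<open>\<open>T\<close> is fixed first, without reference to \<open>\<epsilon>\<close>,
    so \<open>1 / T\<close> is admissible here.\<close>
  define \<epsilon> where "\<epsilon> = min ((1 - \<beta>) / 2) (1 / T)"
  have \<epsilon>: "0 < \<epsilon>" "\<epsilon> \<le> (1 - \<beta>) / 2" "\<epsilon> * T \<le> 1"
    using \<beta>(1) T Tp_pos by (auto simp: \<epsilon>_def min_def field_simps)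
  define v where "v = min (\<delta> / 2) \<epsilon>"
  have v: "0 < v" "v < 1" using \<delta> \<epsilon> \<beta>0 by (auto simp: v_def min_less_iff_disj)
  define c where "c = min (D / (1 + T)) v"
  define W where "W \<kappa> = vel (5 * m + sqrt (1 + m^2) + 16 * \<kappa> / ((1 - \<beta>) * c^2))" for \<kappa>
  define V where "V = max \<beta> (max (W \<kappa>a) (W \<kappa>b))"
  have V: "\<beta> \<le> V" "V < 1" "W \<kappa>a \<le> V" "W \<kappa>b \<le> V"
    using \<beta>(1) vel_less_1 by (auto simp: V_def W_def)
  define A where "A \<kappa> = G * (1 + (Tp + 1)) / ((1 - \<beta>^2) * sqrt (1 - \<beta>^2)) + 8 * \<kappa> / ((1 - V) * c^2)" for \<kappa>
  have "0 < 1 - \<beta>^2" by (rule one_minus_sq_pos) (use \<beta>0 \<beta>(1) in simp)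
  then have A: "0 \<le> A \<kappa>a" "0 \<le> A \<kappa>b"
    using G(1) Tp_pos V(2) \<kappa>a_pos \<kappa>b_pos by (auto simp: A_def intro!: add_nonneg_nonneg divide_nonneg_nonneg mult_nonneg_nonneg)
  \<comment> \<open>Strict inequalities come from halving \<open>D\<close> and \<open>v\<close>,
    moving \<open>V\<close> halfway to 1 and adding 1 to the acceleration constants.\<close>
  have main: "let X = (\<lambda>t. x t + x0 t); Y = (\<lambda>t. y t + y0 t) in
        sup_norm {0..} (dot_on {0..} X) < ereal ((1 + V) / 2) \<and>
        sup_norm {Tm..} (dot_on {Tm..} Y) < ereal ((1 + V) / 2) \<and>
        (INF t\<in>{0..}. ereal (X t - Y t)) > ereal (D / 2) \<and>
        (INF t\<in>{T..}. ereal (dot_on {0..} X t - dot_on {Tm..} Y t)) > ereal (v / 2) \<and>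
        dot_on {0..} X differentiable_on {0..} \<and>
        dot_on {Tp<..} Y differentiable_on {Tp<..} \<and>
        (\<forall>t\<ge>0. \<bar>ddot_on {0..} X t\<bar> < (A \<kappa>a + A \<kappa>b + 1) / (1 + \<bar>t\<bar>)) \<and>
        (\<forall>t>Tp. \<bar>ddot_on {Tp<..} Y t\<bar> < (A \<kappa>a + A \<kappa>b + 1) / (1 + \<bar>t\<bar>))"
    if l: "l \<in> {0..1}" and xy: "(x, y) \<in> M Tm Tp x0 y0"
      and H: "\<forall>t\<ge>0. H1 \<kappa>a Tm a0 va x0 y0 l x y t = x t"
        "\<forall>t\<ge>Tm. H2 \<kappa>b Tm Tp b0 x0 y0 l x y t = y t"
    for l x y
  proof -
    define X Y where "X = (\<lambda>t. x t + x0 t)" and "Y = (\<lambda>t. y t + y0 t)"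
    define X' Y' where "X' = dot_on {0..} X" and "Y' = dot_on {Tm..} Y"
    obtain q where "two_body Tm Tp q l \<beta> \<kappa>a \<kappa>b X Y X' Y' x0' x0'' y0' y0'' x0 y0 I\<^sub>0 \<delta>"
      unfolding X'_def Y'_def X_def Y_def \<delta>_def
      using two_body_fixed_point[of l x y \<beta> I\<^sub>0] l xy H \<beta> I\<^sub>0 by auto
    then interpret S: two_body Tm Tp q l \<beta> \<kappa>a \<kappa>b X Y X' Y' x0' x0'' y0' y0'' x0 y0 I\<^sub>0 \<delta> .
    have XY0: "X 0 - Y 0 = d0"
      using S.X_initial S.Y_initial[of 0] Tm_neg Tp_pos by (simp add: d0_def)
    \<comment> \<open>The two regimes meet here; from this point on nothing depends on the size of
      \<open>l\<close>.\<close>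
    have bounds: "(\<forall>t\<ge>0. D \<le> X t - Y t) \<and> (\<forall>t\<ge>T. v \<le> X' t - Y' t)"
    proof (cases "l \<le> l0")
      case True
      then have "4 * m * l \<le> (4 * m + 1) * l0" using m l by (intro mult_mono) auto
      also have "(4 * m + 1) * l0 = min (\<delta> / 2) (I\<^sub>0 / 2 / (Tp + 1))" using m by (simp add: l0_def)
      finally have small: "4 * m * l \<le> \<delta> / 2" "4 * m * l \<le> I\<^sub>0 / 2 / (Tp + 1)" by auto
      have "4 * m * l * (Tp + 1) \<le> I\<^sub>0 / 2"
        by (rule pos_le_divide_eq[THEN iffD1, OF _ small(2)]) (use Tp_pos in simp)
      then show ?thesis
        using S.distance_weak S.relative_velocity_weak small(1) T
        by (auto simp: m_def[symmetric] D_def v_def min_le_iff_disj)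
    next
      case False
      then have l0': "l0 \<le> l" by simp
      have "\<epsilon> \<le> X' t - Y' t" if "T \<le> t" for t
        by (rule S.relative_velocity_strong[OF l0 l0' \<epsilon> _ _ that])
          (use T long in \<open>auto simp: XY0 m_def[symmetric] m1_def[symmetric] K_def\<close>)
      then show ?thesis
        using S.distance_strong[OF l0 l0'] unfolding XY0 m_def[symmetric]
        by (auto simp: D_def v_def min_le_iff_disj)
    qed
    then have D': "D \<le> X t - Y t" if "0 \<le> t" for t using that by blast
    have v': "v \<le> X' t - Y' t" if "T \<le> t" for t using bounds that by blast
    have T0: "0 \<le> T" using T Tp_pos by simp
    note uniform = D D' v(1) v' T0 c_def V(1,2) V(3,4)[unfolded W_def m_def]
    have X'_le: "\<bar>X' t\<bar> \<le> V" if "0 \<le> t" for t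
      by (rule S.abs_X'_le[OF uniform that])
    have Y'_le: "\<bar>Y' t\<bar> \<le> V" if "Tm \<le> t" for t
      by (rule S.abs_Y'_le[OF uniform that])
    have increase: "a / (1 + t) < (A \<kappa>a + A \<kappa>b + 1) / (1 + \<bar>t\<bar>)" if "0 \<le> t" "a \<in> A ` {\<kappa>a, \<kappa>b}" for a t
      using that A by (auto intro!: divide_strict_right_mono)
    have accX: "\<exists>E. (X' has_real_derivative E) (at t within {0..}) \<and> \<bar>E\<bar> \<le> A \<kappa>a / (1 + t)"
      if "0 \<le> t" for t
      unfolding A_def by (rule S.X'_deriv[OF uniform]) (use G Tp_pos ref(14) that in auto)
    have accY: "\<exists>E. (Y' has_real_derivative E) (at t) \<and> \<bar>E\<bar> \<le> A \<kappa>b / (1 + t)"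
      if "Tp < t" for t
      unfolding A_def by (rule S.Y'_deriv[OF uniform]) (use G Tp_pos ref(15) that in auto)
    have accY': "\<exists>E. (dot_on {Tp<..} Y has_real_derivative E) (at t within {Tp<..}) \<and> \<bar>E\<bar> \<le> A \<kappa>b / (1 + t)"
      if t: "Tp < t" for t
    proof -
      have Y': "Y' s = dot_on {Tp<..} Y s" if "s \<in> {Tp<..}" for s
        using that by (simp add: Y'_def dot_on_Ioi)
      obtain E where E: "(Y' has_real_derivative E) (at t)" "\<bar>E\<bar> \<le> A \<kappa>b / (1 + t)" using accY[OF t] by blast
      have "(dot_on {Tp<..} Y has_real_derivative E) (at t)"
        by (rule has_field_derivative_transform_within_open[OF E(1), of "{Tp<..}"]) (use Y' t in auto)
      then show ?thesis using E(2) has_field_derivative_at_within by blast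
    qed
    have ddX: "\<bar>ddot_on {0..} X t\<bar> < (A \<kappa>a + A \<kappa>b + 1) / (1 + \<bar>t\<bar>)" if t: "0 \<le> t" for t
    proof -
      obtain E where E: "(X' has_real_derivative E) (at t within {0..})" "\<bar>E\<bar> \<le> A \<kappa>a / (1 + t)" using accX[OF t] by blast
      have "ddot_on {0..} X t = E"
        unfolding ddot_on_def X'_def[symmetric] by (rule dot_on_eqI[OF E(1) at_within_atLeast_neq_bot[OF t]])
      then show ?thesis using E(2) increase[OF t, of "A \<kappa>a"] by simp
    qed
    have ddY: "\<bar>ddot_on {Tp<..} Y t\<bar> < (A \<kappa>a + A \<kappa>b + 1) / (1 + \<bar>t\<bar>)" if t: "Tp < t" for t
    proof -
      obtain E where E: "(dot_on {Tp<..} Y has_real_derivative E) (at t within {Tp<..})" "\<bar>E\<bar> \<le> A \<kappa>b / (1 + t)"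
        using accY'[OF t] by blast
      have "ddot_on {Tp<..} Y t = E"
        unfolding ddot_on_def by (rule dot_on_eqI[OF E(1)]) (simp add: at_within_greaterThan[OF t])
      then show ?thesis using E(2) increase[of t "A \<kappa>b"] t Tp_pos by simp
    qed
    have "X' differentiable_on {0..}" "dot_on {Tp<..} Y differentiable_on {Tp<..}"
      unfolding differentiable_on_def
      using accX accY' by (meson atLeast_iff greaterThan_iff has_field_derivative_imp_has_derivative differentiable_def)+
    moreover have "sup_norm {0..} X' < ereal ((1 + V) / 2)" "sup_norm {Tm..} Y' < ereal ((1 + V) / 2)"
      by (rule sup_norm_less[of _ _ V]; use X'_le Y'_le V(2) in simp)+
    moreover have "ereal (D / 2) < (INF t\<in>{0..}. ereal (X t - Y t))"
      by (rule less_INF_ereal[of _ D]) (use D D' in auto)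
    moreover have "ereal (v / 2) < (INF t\<in>{T..}. ereal (X' t - Y' t))"
      by (rule less_INF_ereal[of _ v]) (use v v' in auto)
    ultimately show ?thesis
      unfolding Let_def X_def[symmetric] Y_def[symmetric] X'_def[symmetric] Y'_def[symmetric]
      using ddX ddY by blast
  qed
  have constants: "v / 2 \<in> {0<..<1}" "(1 + V) / 2 \<in> {0<..<1}" "0 < A \<kappa>a + A \<kappa>b + 1" "0 < D / 2" "0 < T"
    using v V(1,2) \<beta>0 A D T Tp_pos by auto
  show ?thesis
    by (rule exI[of _ "v / 2"], rule exI[of _ "(1 + V) / 2"], rule exI[of _ "A \<kappa>a + A \<kappa>b + 1"],
        rule exI[of _ "D / 2"], rule exI[of _ T]) (use constants main in blast)
qed

end
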